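(* Let $[u]=[\vec u+\varepsilon u_0]$ be a rational kinematic torse with Gauss map $n=\vec u/\sqrt{N(\vec u)}$. Let $\deg u$ denote the degree of the torse $[u]$ and $\deg n$ the degree of $n$ as a rational curve. Then the following hold. (1) There exists a rational motion $[C]$ of degree $\deg u-\tfrac12\deg n$ with trajectory $[u]$. (2) The degree of this rational motion is minimal, i.e. no rational motion with trajectory $[u]$ has degree smaller than $\deg u-\tfrac12\deg n$. (3) The rational motion of minimal degree with trajectory $[u]$ is essentially unique if and only if $\deg u=\deg n$. (4) All rational motions with trajectory $[u]$ are obtained by composing $[C]$ (the rational motion of minimal degree from (1)) from the right with any rational motion $[E]$ that fixes the plane $[\mathbf{k}]$; that is, the rational motions with trajectory $[u]$ are exactly the $[CE]$ where $[E]$ is a rational motion with $[E_\varepsilon\,\mathbf{k}\,E^*]=[\mathbf{k}]$. (This implies that $E$ is given by a polynomial of the shape $E=e_0+e_3\mathbf{k}+\varepsilon(e_5\mathbf{i}+e_6\mathbf{j})$ with $e_0,e_3,e_5,e_6\in\mathbb{R}[t]$.)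
   Context: $\mathbb{H}$ denotes the real quaternions with basis $1,\mathbf{i},\mathbf{j},\mathbf{k}$ and conjugation $q\mapsto q^*$. The dual quaternions are $\mathbb{DH}=\{p+\varepsilon d: p,d\in\mathbb{H}\}$, where $\varepsilon^2=0$ and $\varepsilon$ commutes with everything; $p$ is the primal part and $d$ the dual part. For $h=p+\varepsilon d$ set $h^*=p^*+\varepsilon d^*$, $h_\varepsilon=p-\varepsilon d$ and $N(h)=hh^*$. Scalars are extended to $\mathbb{R}[t]$ and $\mathbb{R}(t)$; $t$ commutes with all dual quaternions and is unaffected by the conjugations. Consider the projective space over the $\mathbb{R}(t)$-vector space of dual quaternions with coefficients in $\mathbb{R}(t)$; $[x]$ denotes the point represented by $x\ne0$, so $[x]=[rx]$ for all $r\in\mathbb{R}(t)\setminus\{0\}$. - A rational curve is a point $[\gamma]$ with $\gamma=\gamma_0+\varepsilon(\gamma_1\mathbf{i}+\gamma_2\mathbf{j}+\gamma_3\mathbf{k})$; it represents $(\gamma_1,\gamma_2,\gamma_3)/\gamma_0$. - A rational torse is a point $[u]$ with $u=\vec u+\varepsilon u_0$, $\vec u=u_1\mathbf{i}+u_2\mathbf{j}+u_3\mathbf{k}$. It represents the one-parameter family of planes $u_0+u_1x+u_2y+u_3z=0$. A polynomial representative $u$ (all $u_i\in\mathbb{R}[t]$) is called a plane polynomial. - A rational motion is a point $[C]$ with $C=P+\varepsilon D$, $P\neq0$ and $PD^*+DP^*=0$ (Study condition). The degree of a rational curve, torse or motion is the minimal degree of a polynomial representing it; equivalently, the degree of a representing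 polynomial in $\mathbb{DH}[t]$ having no real polynomial factor of positive degree. A plane polynomial $u$ is kinematic if its norm $N(u)=N(\vec u)$ is a square in $\mathbb{R}[t]$. A rational torse is kinematic if it can be represented by a kinematic plane polynomial. The Gauss map is then the rational curve $n=\vec u/\sqrt{N(\vec u)}$ (with $\vec u\ne0$), and $\deg n$ is its degree as a rational curve. The moving plane is taken to be the plane $[\mathbf{k}]$: a rational motion $[C]$ has trajectory $[u]$ if $[u]=[C_\varepsilon\,\mathbf{k}\,C^*]$. Composition of motions corresponds to multiplication of dual quaternions. Essential uniqueness of $[C]$ means uniqueness up to right multiplication with a constant displacement $[e]$ ($e\in\mathbb{DH}$ with $ee^*\in\mathbb{R}\setminus\{0\}$) that fixes the plane $[\mathbf{k}]$, i.e. $[e_\varepsilon\mathbf{k}e^*]=[\mathbf{k}]$.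
   Formalization: The closing remark on the shape of E fails for E = i, which fixes [k] since i k i* = −k; it is replaced by: either E_ε k E* = N(E) k and E has the stated shape, or E_ε k E* = −N(E) k and E i has the stated shape. *)

theory Defs
  imports "HOL-Computational_Algebra.Computational_Algebra"
begin

section \<open>Quaternions over a commutative ring\<close>

codatatype 'a quat = Quat (q0: 'a) (q1: 'a) (q2: 'a) (q3: 'a)

lemma quat_eq_iff: "x = y \<longleftrightarrow> q0 x = q0 y \<and> q1 x = q1 y \<and> q2 x = q2 y \<and> q3 x = q3 y"
  by (auto intro: quat.expand)

instantiation quat :: (comm_ring_1) ring_1
begin

primcorec zero_quat :: "'a quat" where
  "q0 0 = 0" | "q1 0 = 0" | "q2 0 = 0" | "q3 0 = 0"

primcorec one_quat :: "'a quat" where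
  "q0 1 = 1" | "q1 1 = 0" | "q2 1 = 0" | "q3 1 = 0"

primcorec plus_quat :: "'a quat \<Rightarrow> 'a quat \<Rightarrow> 'a quat" where
  "q0 (x + y) = q0 x + q0 y"
| "q1 (x + y) = q1 x + q1 y"
| "q2 (x + y) = q2 x + q2 y"
| "q3 (x + y) = q3 x + q3 y"

primcorec uminus_quat :: "'a quat \<Rightarrow> 'a quat" where
  "q0 (- x) = - q0 x"
| "q1 (- x) = - q1 x"
| "q2 (- x) = - q2 x"
| "q3 (- x) = - q3 x"

primcorec minus_quat :: "'a quat \<Rightarrow> 'a quat \<Rightarrow> 'a quat" where
  "q0 (x - y) = q0 x - q0 y"
| "q1 (x - y) = q1 x - q1 y"
| "q2 (x - y) = q2 x - q2 y"
| "q3 (x - y) = q3 x - q3 y"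

primcorec times_quat :: "'a quat \<Rightarrow> 'a quat \<Rightarrow> 'a quat" where
  "q0 (x * y) = q0 x * q0 y - q1 x * q1 y - q2 x * q2 y - q3 x * q3 y"
| "q1 (x * y) = q0 x * q1 y + q1 x * q0 y + q2 x * q3 y - q3 x * q2 y"
| "q2 (x * y) = q0 x * q2 y - q1 x * q3 y + q2 x * q0 y + q3 x * q1 y"
| "q3 (x * y) = q0 x * q3 y + q1 x * q2 y - q2 x * q1 y + q3 x * q0 y"

instance
  by standard (simp_all add: quat_eq_iff algebra_simps)

end

primcorec qcnj :: "'a::comm_ring_1 quat \<Rightarrow> 'a quat" where
  "q0 (qcnj x) = q0 x"
| "q1 (qcnj x) = - q1 x"
| "q2 (qcnj x) = - q2 x"
| "q3 (qcnj x) = - q3 x"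


section \<open>Dual quaternions over a commutative ring\<close>

text \<open>\<open>DQ p d\<close> stands for \<open>p + \<epsilon> d\<close>.\<close>

codatatype 'a dquat = DQ (primal: "'a quat") (dual: "'a quat")

lemma dquat_eq_iff: "x = y \<longleftrightarrow> primal x = primal y \<and> dual x = dual y"
  by (auto intro: dquat.expand)

instantiation dquat :: (comm_ring_1) ring_1
begin

primcorec zero_dquat :: "'a dquat" where
  "primal 0 = 0" | "dual 0 = 0"

primcorec one_dquat :: "'a dquat" where
  "primal 1 = 1" | "dual 1 = 0"

primcorec plus_dquat :: "'a dquat \<Rightarrow> 'a dquat \<Rightarrow> 'a dquat" where
  "primal (x + y) = primal x + primal y"
| "dual (x + y) = dual x + dual y"

primcorec uminus_dquat :: "'a dquat \<Rightarrow> 'a dquat" where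
  "primal (- x) = - primal x"
| "dual (- x) = - dual x"

primcorec minus_dquat :: "'a dquat \<Rightarrow> 'a dquat \<Rightarrow> 'a dquat" where
  "primal (x - y) = primal x - primal y"
| "dual (x - y) = dual x - dual y"

primcorec times_dquat :: "'a dquat \<Rightarrow> 'a dquat \<Rightarrow> 'a dquat" where
  "primal (x * y) = primal x * primal y"
| "dual (x * y) = primal x * dual y + dual x * primal y"

instance
  by standard (simp_all add: dquat_eq_iff algebra_simps)

end

definition scalar :: "'a::comm_ring_1 \<Rightarrow> 'a dquat" where
  "scalar a = DQ (Quat a 0 0 0) 0"

definition dq_i :: "'a::comm_ring_1 dquat" where
  "dq_i = DQ (Quat 0 1 0 0) 0"

definition dq_k :: "'a::comm_ring_1 dquat" where
  "dq_k = DQ (Quat 0 0 0 1) 0"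

definition dcnj :: "'a::comm_ring_1 dquat \<Rightarrow> 'a dquat" where
  "dcnj h = DQ (qcnj (primal h)) (qcnj (dual h))"

definition eps_cnj :: "'a::comm_ring_1 dquat \<Rightarrow> 'a dquat" where
  "eps_cnj h = DQ (primal h) (- dual h)"

definition dnorm :: "'a::comm_ring_1 dquat \<Rightarrow> 'a dquat" where
  "dnorm h = h * dcnj h"


section \<open>The projective space over the field of rational functions\<close>

type_synonym ratfun = "real poly fract"

text \<open>The rings \<open>\<real>[t]\<close> and \<open>\<real>(t)\<close> are \<open>real poly\<close> and \<open>ratfun\<close>. The dual quaternion
  polynomials \<open>\<bbbD>\<bbbH>[t]\<close> are represented by \<open>real poly dquat\<close>, i.e. coordinatewise, since
  \<open>t\<close> is central.\<close>

definition of_polys :: "real poly dquat \<Rightarrow> ratfun dquat" where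
  "of_polys = map_dquat to_fract"

definition of_consts :: "real dquat \<Rightarrow> ratfun dquat" where
  "of_consts = map_dquat (\<lambda>a. to_fract [:a:])"

text \<open>The point \<open>[x]\<close>, as the set of all its representatives (meaningful for \<open>x \<noteq> 0\<close>).\<close>

definition point :: "ratfun dquat \<Rightarrow> ratfun dquat set" where
  "point x = {scalar r * x | r. r \<noteq> 0}"

definition quat_degree :: "real poly quat \<Rightarrow> nat" where
  "quat_degree q = Max {degree (q0 q), degree (q1 q), degree (q2 q), degree (q3 q)}"

definition dquat_degree :: "real poly dquat \<Rightarrow> nat" where
  "dquat_degree h = max (quat_degree (primal h)) (quat_degree (dual h))"

definition point_degree :: "ratfun dquat set \<Rightarrow> nat" where
  "point_degree X = (LEAST n. \<exists>h. of_polys h \<in> X \<and> dquat_degree h = n)"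


section \<open>Torses, Gauss maps and motions\<close>

text \<open>The vectors \<open>u\<^sub>1\<i> + u\<^sub>2\<j> + u\<^sub>3\<k> + \<epsilon> u\<^sub>0\<close>. Over \<open>real poly\<close> these are the plane
  polynomials, over \<open>ratfun\<close> the representatives of rational torses.\<close>

definition plane_form :: "'a::comm_ring_1 dquat \<Rightarrow> bool" where
  "plane_form u \<longleftrightarrow> u \<noteq> 0 \<and> q0 (primal u) = 0 \<and>
     q1 (dual u) = 0 \<and> q2 (dual u) = 0 \<and> q3 (dual u) = 0"

definition kinematic_plane_poly :: "real poly dquat \<Rightarrow> bool" where
  "kinematic_plane_poly u \<longleftrightarrow> plane_form u \<and> (\<exists>w. dnorm u = scalar (w\<^sup>2))"

definition rational_kinematic_torse :: "ratfun dquat \<Rightarrow> bool" where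
  "rational_kinematic_torse u \<longleftrightarrow> plane_form u \<and>
     (\<exists>v. kinematic_plane_poly v \<and> point (of_polys v) = point u)"

text \<open>A rational curve \<open>(\<gamma>\<^sub>1, \<gamma>\<^sub>2, \<gamma>\<^sub>3) / \<gamma>\<^sub>0\<close> is represented by
  \<open>\<gamma>\<^sub>0 + \<epsilon>(\<gamma>\<^sub>1\<i> + \<gamma>\<^sub>2\<j> + \<gamma>\<^sub>3\<k>)\<close>; here \<open>\<gamma>\<^sub>0\<close> is one of the two square roots of the
  norm, so that the Gauss map is determined up to sign.\<close>

definition gauss_map :: "ratfun dquat \<Rightarrow> ratfun dquat \<Rightarrow> bool" where
  "gauss_map u n \<longleftrightarrow> primal u \<noteq> 0 \<and>
     (\<exists>w. dnorm u = scalar (w\<^sup>2) \<and> n = DQ (Quat w 0 0 0) (primal u))"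

definition rational_motion :: "ratfun dquat \<Rightarrow> bool" where
  "rational_motion C \<longleftrightarrow> primal C \<noteq> 0 \<and>
     primal C * qcnj (dual C) + dual C * qcnj (primal C) = 0"

definition has_trajectory :: "ratfun dquat \<Rightarrow> ratfun dquat \<Rightarrow> bool" where
  "has_trajectory C u \<longleftrightarrow> point u = point (eps_cnj C * dq_k * dcnj C)"

abbreviation fixes_plane_k :: "ratfun dquat \<Rightarrow> bool" where
  "fixes_plane_k E \<equiv> has_trajectory E dq_k"

definition minimal_motion :: "ratfun dquat \<Rightarrow> ratfun dquat \<Rightarrow> bool" where
  "minimal_motion u C \<longleftrightarrow> rational_motion C \<and> has_trajectory C u \<and>
     (\<forall>C'. rational_motion C' \<and> has_trajectory C' u \<longrightarrow>
        point_degree (point C) \<le> point_degree (point C'))"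

definition constant_displacement :: "real dquat \<Rightarrow> bool" where
  "constant_displacement e \<longleftrightarrow> (\<exists>r. r \<noteq> 0 \<and> e * dcnj e = scalar r)"

definition essentially_unique_minimal_motion :: "ratfun dquat \<Rightarrow> bool" where
  "essentially_unique_minimal_motion u \<longleftrightarrow>
     (\<forall>C C'. minimal_motion u C \<and> minimal_motion u C' \<longrightarrow>
        (\<exists>e. constant_displacement e \<and> fixes_plane_k (of_consts e) \<and>
             point C' = point (C * of_consts e)))"

text \<open>The dual quaternion polynomials \<open>e\<^sub>0 + e\<^sub>3\<k> + \<epsilon>(e\<^sub>5\<i> + e\<^sub>6\<j>)\<close>. They fix the plane
  \<open>[\<k>]\<close> together with its orientation. The half turn \<open>\<i>\<close> maps \<open>\<k>\<close> to \<open>- \<k>\<close>, hence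
  also fixes the projective point \<open>[\<k>]\<close>, but is not of this shape.\<close>

definition planar_shape :: "ratfun dquat \<Rightarrow> bool" where
  "planar_shape E \<longleftrightarrow>
     (\<exists>e0 e3 e5 e6. point E = point (of_polys (DQ (Quat e0 0 0 e3) (Quat 0 e5 e6 0))))"

end

theory Submission
  imports Defs "HOL-Computational_Algebra.Field_as_Ring"
begin

text \<open>Write a quaternion polynomial as \<open>x = A + i B\<close> with \<open>A, B\<close> in \<open>\<real>[t] + \<real>[t] k\<close>, a copy of
  \<open>\<complex>[t]\<close>. Then \<open>x\<close> is a pair \<open>(a, b)\<close> of complex polynomials, and \<open>x k x\<^sup>*\<close> consists of
  \<open>\<bar>a\<bar>\<^sup>2 - \<bar>b\<bar>\<^sup>2\<close> and twice the product of \<open>b\<close> with the conjugate of \<open>a\<close>. A reduced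
  representative of the torse has the form \<open>g x k x\<^sup>* + \<epsilon> v\<close> with \<open>a, b\<close> coprime and \<open>g, v\<close>
  coprime, and \<open>deg n = 2 deg x\<close>.

  A motion \<open>P + \<epsilon> D\<close> with this trajectory has \<open>P = x e\<close> or \<open>P = x e i\<close> for some \<open>e\<close> in
  \<open>\<real>[t] + \<real>[t] k\<close>, and the trajectory together with the Study condition prescribes the Hermitian
  product of \<open>P\<close> and \<open>D\<close>. For \<open>P = g x\<close> this is a Bezout equation for \<open>D\<close>, solvable in degree
  \<open>deg u - deg x\<close>. Coprimality of \<open>g\<close> and \<open>v\<close> forces the conjugate of \<open>e\<close> to divide the
  scaling factor of the trajectory, which gives the lower bound. The solution \<open>D\<close> is unique up to adding
  right multiples \<open>x j \<lambda>\<close>, and \<open>\<lambda>\<close> must be constant exactly if \<open>deg u = 2 deg x\<close>.\<close>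

section \<open>Quaternion identities\<close>

definition qk :: "'a::comm_ring_1 quat" where
  "qk = Quat 0 0 0 1"

text \<open>The polarized norm, i.e. the real part of \<open>x * qcnj y\<close>.\<close>

definition qinner :: "'a::comm_ring_1 quat \<Rightarrow> 'a quat \<Rightarrow> 'a" where
  "qinner x y = q0 x * q0 y + q1 x * q1 y + q2 x * q2 y + q3 x * q3 y"

text \<open>The vector k, rotated by \<open>x\<close> and stretched by the norm of
  \<open>x\<close>.\<close>

definition qrot :: "'a::comm_ring_1 quat \<Rightarrow> 'a quat" where
  "qrot x = x * qk * qcnj x"

lemma qk_sel [simp]: "q0 qk = 0" "q1 qk = 0" "q2 qk = 0" "q3 qk = 1"
  by (simp_all add: qk_def)

text \<open>Sums of squares in an ordered ring: this covers the reals, \<open>real poly\<close> and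
  its fraction field alike.\<close>

lemma qinner_self_eq_0_iff [simp]: "qinner x x = 0 \<longleftrightarrow> x = 0"
  for x :: "'a::linordered_idom quat"
proof
  assume "qinner x x = 0"
  moreover have "q0 x * q0 x \<ge> 0" "q1 x * q1 x \<ge> 0" "q2 x * q2 x \<ge> 0" "q3 x * q3 x \<ge> 0"
    by simp_all
  ultimately have "q0 x * q0 x = 0 \<and> q1 x * q1 x = 0 \<and> q2 x * q2 x = 0 \<and> q3 x * q3 x = 0"
    unfolding qinner_def by linarith
  then show "x = 0" by (simp add: quat_eq_iff)
qed (simp add: qinner_def)

lemma qrot_sel:
  "q0 (qrot x) = 0"
  "q1 (qrot x) = 2 * (q1 x * q3 x + q0 x * q2 x)"
  "q2 (qrot x) = 2 * (q2 x * q3 x - q0 x * q1 x)"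
  "q3 (qrot x) = q0 x * q0 x - q1 x * q1 x - q2 x * q2 x + q3 x * q3 x"
  by (simp_all add: qrot_def algebra_simps)

lemma qinner_qrot: "qinner (qrot x) (qrot x) = (qinner x x)\<^sup>2"
  by (simp add: qinner_def qrot_sel power2_eq_square algebra_simps)

text \<open>With primal part P and dual part D, the two terms \<open>P k D^*\<close> and
  \<open>- D k P^*\<close> of the dual part are conjugate, so that only twice a real part
  survives.\<close>

lemma trajectory_eq:
  "eps_cnj C * dq_k * dcnj C =
     DQ (qrot (primal C)) (Quat (2 * qinner (primal C * qk) (dual C)) 0 0 0)"
  by (simp add: dquat_eq_iff quat_eq_iff eps_cnj_def dcnj_def dq_k_def qrot_sel qinner_def
      algebra_simps)

lemma study_eq:
  "primal C * qcnj (dual C) + dual C * qcnj (primal C) =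
     Quat (2 * qinner (primal C) (dual C)) 0 0 0"
  by (simp add: quat_eq_iff qinner_def algebra_simps)

text \<open>The dual part is the left side of the Study condition; this links motions to elements
  with scalar norm.\<close>

lemma dnorm_eq:
  "dnorm C = DQ (Quat (qinner (primal C) (primal C)) 0 0 0)
                (Quat (2 * qinner (primal C) (dual C)) 0 0 0)"
  by (simp add: dnorm_def dcnj_def dquat_eq_iff quat_eq_iff qinner_def algebra_simps)

lemma dcnj_mult_self: "dcnj C * C = dnorm C"
  by (simp add: dnorm_def dcnj_def dquat_eq_iff quat_eq_iff algebra_simps)

lemma dcnj_mult: "dcnj (x * y) = dcnj y * dcnj x"
  by (simp add: dcnj_def dquat_eq_iff quat_eq_iff algebra_simps)

lemma dcnj_dcnj [simp]: "dcnj (dcnj x) = x"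
  by (simp add: dcnj_def dquat_eq_iff quat_eq_iff)

lemma eps_cnj_mult: "eps_cnj (x * y) = eps_cnj x * eps_cnj y"
  by (simp add: eps_cnj_def dquat_eq_iff)

lemma scalar_mult_sel [simp]:
  "q0 (primal (scalar a * x)) = a * q0 (primal x)"
  "q1 (primal (scalar a * x)) = a * q1 (primal x)"
  "q2 (primal (scalar a * x)) = a * q2 (primal x)"
  "q3 (primal (scalar a * x)) = a * q3 (primal x)"
  "q0 (dual (scalar a * x)) = a * q0 (dual x)"
  "q1 (dual (scalar a * x)) = a * q1 (dual x)"
  "q2 (dual (scalar a * x)) = a * q2 (dual x)"
  "q3 (dual (scalar a * x)) = a * q3 (dual x)"
  by (simp_all add: scalar_def)

lemma scalar_sel [simp]:
  "primal (scalar a) = Quat a 0 0 0" "dual (scalar a) = 0"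
  by (simp_all add: scalar_def)

lemma scalar_1 [simp]: "scalar 1 = 1"
  by (simp add: dquat_eq_iff quat_eq_iff)

lemma scalar_mult: "scalar (a * b) = scalar a * scalar b"
  by (simp add: dquat_eq_iff quat_eq_iff)

lemma scalar_commute: "x * scalar a = scalar a * x"
  by (simp add: dquat_eq_iff quat_eq_iff algebra_simps)

lemma scalar_left_commute: "x * (scalar a * y) = scalar a * (x * y)"
  by (metis mult.assoc scalar_commute)

lemma dcnj_scalar [simp]: "dcnj (scalar a) = scalar a"
  and eps_cnj_scalar [simp]: "eps_cnj (scalar a) = scalar a"
  by (simp_all add: dcnj_def eps_cnj_def dquat_eq_iff quat_eq_iff)

lemma scalar_mult_eq_0_iff [simp]: "scalar a * x = 0 \<longleftrightarrow> a = 0 \<or> x = 0"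
  for a :: "'a::idom"
  by (auto simp: dquat_eq_iff quat_eq_iff)

lemma dnorm_mult_scalar:
  assumes "dnorm y = scalar b"
  shows "dnorm (x * y) = scalar b * dnorm x"
proof -
  have "dnorm (x * y) = x * (y * dcnj y) * dcnj x"
    by (simp add: dnorm_def dcnj_mult mult.assoc)
  also have "\<dots> = x * scalar b * dcnj x"
    using assms by (simp add: dnorm_def)
  finally show ?thesis
    by (simp add: dnorm_def scalar_commute mult.assoc)
qed

section \<open>Polynomial representatives\<close>

lemma map_quat_sel [simp]:
  "q0 (map_quat f x) = f (q0 x)" "q1 (map_quat f x) = f (q1 x)"
  "q2 (map_quat f x) = f (q2 x)" "q3 (map_quat f x) = f (q3 x)"
  by (simp_all add: quat.map_sel)

lemma of_polys_sel [simp]: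
  "primal (of_polys x) = map_quat to_fract (primal x)"
  "dual (of_polys x) = map_quat to_fract (dual x)"
  by (simp_all add: of_polys_def dquat.map_sel)

lemma of_polys_mult: "of_polys (x * y) = of_polys x * of_polys y"
  by (simp add: dquat_eq_iff quat_eq_iff)

lemma of_polys_dcnj: "of_polys (dcnj x) = dcnj (of_polys x)"
  and of_polys_eps_cnj: "of_polys (eps_cnj x) = eps_cnj (of_polys x)"
  and of_polys_scalar: "of_polys (scalar a) = scalar (to_fract a)"
  and of_polys_dq_k: "of_polys dq_k = dq_k"
  by (simp_all add: dquat_eq_iff quat_eq_iff dcnj_def eps_cnj_def dq_k_def dq_i_def)

lemma of_polys_eq_iff [simp]: "of_polys x = of_polys y \<longleftrightarrow> x = y"
  by (simp add: dquat_eq_iff quat_eq_iff)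

lemma of_polys_0 [simp]: "of_polys 0 = 0"
  by (simp add: dquat_eq_iff quat_eq_iff)

lemma of_polys_eq_0_iff [simp]: "of_polys x = 0 \<longleftrightarrow> x = 0"
  using of_polys_eq_iff[of x 0] by (simp del: of_polys_eq_iff)

lemma self_in_point [simp]: "x \<in> point x"
  unfolding point_def by (rule CollectI, rule exI[of _ 1]) simp

lemma point_eq_iff: "point x = point y \<longleftrightarrow> (\<exists>r. r \<noteq> 0 \<and> x = scalar r * y)"
proof
  assume "point x = point y"
  then have "x \<in> point y" using self_in_point by metis
  then show "\<exists>r. r \<noteq> 0 \<and> x = scalar r * y" by (auto simp: point_def)
next
  assume "\<exists>r. r \<noteq> 0 \<and> x = scalar r * y"
  then obtain r where r: "r \<noteq> 0" "x = scalar r * y" by blast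
  show "point x = point y"
  proof (intro set_eqI iffI)
    fix z assume "z \<in> point x"
    then obtain s where "s \<noteq> 0" "z = scalar s * x" by (auto simp: point_def)
    with r show "z \<in> point y"
      unfolding point_def by (intro CollectI exI[of _ "s * r"]) (simp add: scalar_mult mult.assoc)
  next
    fix z assume "z \<in> point y"
    then obtain s where "s \<noteq> 0" "z = scalar s * y" by (auto simp: point_def)
    with r show "z \<in> point x"
      unfolding point_def
      by (intro CollectI exI[of _ "s / r"]) (simp flip: mult.assoc scalar_mult)
  qed
qed

lemma in_point_iff: "x \<in> point y \<longleftrightarrow> point x = point y"
  unfolding point_eq_iff by (auto simp: point_def)

lemma ratfun_common_denominator:
  fixes A :: "ratfun set"
  assumes "finite A"
  shows "\<exists>b. b \<noteq> 0 \<and> (\<forall>x\<in>A. \<exists>a. to_fract b * x = to_fract a)"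
  using assms
proof (induction A)
  case empty
  show ?case by (rule exI[of _ 1]) simp
next
  case (insert x A)
  then obtain b where b: "b \<noteq> 0" "\<forall>x\<in>A. \<exists>a. to_fract b * x = to_fract a" by blast
  define p c where "p = fst (quot_of_fract x)" and "c = snd (quot_of_fract x)"
  then have c: "c \<noteq> 0" "x = to_fract p / to_fract c"
    by (simp_all flip: Fract_conv_to_fract)
  have "\<exists>a. to_fract (b * c) * y = to_fract a" if "y \<in> insert x A" for y
  proof (cases "y = x")
    case True
    then have "to_fract (b * c) * y = to_fract (b * p)" using c by simp
    then show ?thesis by blast
  next
    case False
    with that b obtain a where "to_fract b * y = to_fract a" by blast
    then have "to_fract (b * c) * y = to_fract (c * a)" by (simp add: mult_ac)
    then show ?thesis by blast
  qed
  with b(1) c(1) show ?case by (intro exI[of _ "b * c"]) auto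
qed

lemma polynomial_representative: "\<exists>h. of_polys h \<in> point x"
proof -
  let ?A = "{q0 (primal x), q1 (primal x), q2 (primal x), q3 (primal x),
             q0 (dual x), q1 (dual x), q2 (dual x), q3 (dual x)}"
  obtain b where b: "b \<noteq> 0" "\<forall>y\<in>?A. \<exists>a. to_fract b * y = to_fract a"
    using ratfun_common_denominator[of ?A] by auto
  then have "\<exists>a0 a1 a2 a3 d0 d1 d2 d3. scalar (to_fract b) * x =
      of_polys (DQ (Quat a0 a1 a2 a3) (Quat d0 d1 d2 d3))"
    by (simp add: dquat_eq_iff quat_eq_iff)
  then obtain h where "of_polys h = scalar (to_fract b) * x" by auto
  with b(1) show ?thesis
    unfolding point_def by (intro exI[of _ h] CollectI exI[of _ "to_fract b"]) simp
qed

lemma point_degree_le: "of_polys h \<in> point x \<Longrightarrow> point_degree (point x) \<le> dquat_degree h"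
  unfolding point_degree_def by (rule Least_le) blast

lemma minimal_representative:
  obtains h where "of_polys h \<in> point x" "dquat_degree h = point_degree (point x)"
proof -
  have "\<exists>n h. of_polys h \<in> point x \<and> dquat_degree h = n"
    using polynomial_representative by blast
  from LeastI_ex[OF this] show ?thesis
    using that unfolding point_degree_def by blast
qed

section \<open>Degrees of dual quaternion polynomials\<close>

lemma quat_degree_le_iff:
  "quat_degree q \<le> n \<longleftrightarrow> degree (q0 q) \<le> n \<and> degree (q1 q) \<le> n \<and> degree (q2 q) \<le> n \<and> degree (q3 q) \<le> n"
  by (simp add: quat_degree_def)

lemma quat_degree_real [simp]: "quat_degree (Quat a 0 0 0) = degree a"
  and quat_degree_0 [simp]: "quat_degree 0 = 0"
  by (simp_all add: quat_degree_def)

lemma dquat_degree_le_iff: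
  "dquat_degree h \<le> n \<longleftrightarrow> quat_degree (primal h) \<le> n \<and> quat_degree (dual h) \<le> n"
  by (simp add: dquat_degree_def)

lemma dquat_degree_scalar_mult:
  assumes "p \<noteq> 0" "h \<noteq> 0"
  shows "dquat_degree (scalar p * h) = degree p + dquat_degree h"
proof (rule antisym)
  have *: "degree (p * c) \<le> degree p + n" if "degree c \<le> n" for c n
    using that by (meson add_left_mono degree_mult_le order_trans)
  have "dquat_degree h \<le> dquat_degree h" ..
  then show "dquat_degree (scalar p * h) \<le> degree p + dquat_degree h"
    unfolding dquat_degree_le_iff[of "scalar _ * _"] dquat_degree_le_iff[of h]
      quat_degree_le_iff scalar_mult_sel by (auto intro!: *)
next
  \<comment> \<open>A nonzero coordinate attains the degree. Since the polynomial 0 also has degree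
    0, the case of total degree 0 relies on \<open>h\<close> being nonzero.\<close>
  have ex: "\<exists>c \<in> {q0 (primal h), q1 (primal h), q2 (primal h), q3 (primal h),
             q0 (dual h), q1 (dual h), q2 (dual h), q3 (dual h)}.
        c \<noteq> 0 \<and> dquat_degree h \<le> degree c" (is "\<exists>c\<in>?S. _")
  proof (rule ccontr)
    assume "\<not> ?thesis"
    then have neg: "degree c < dquat_degree h" if "c \<in> ?S" "c \<noteq> 0" for c
      using that not_le by blast
    obtain c0 where "c0 \<in> ?S" "c0 \<noteq> 0"
      using assms(2) by (auto simp: dquat_eq_iff quat_eq_iff)
    from neg[OF this] have pos: "dquat_degree h > 0" by simp
    then have "degree c \<le> dquat_degree h - 1" if "c \<in> ?S" for c
      using neg[OF that] by (cases "c = 0") auto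
    then have "dquat_degree h \<le> dquat_degree h - 1"
      unfolding dquat_degree_le_iff[of h] quat_degree_le_iff by simp
    with pos show False by simp
  qed
  then obtain c where c: "c \<in> ?S" "c \<noteq> 0" "dquat_degree h \<le> degree c" by blast
  have "degree (p * c) \<le> dquat_degree (scalar p * h)"
    using c(1) dquat_degree_le_iff[of "scalar p * h" "dquat_degree (scalar p * h)"]
    by (auto simp: quat_degree_le_iff)
  then show "degree p + dquat_degree h \<le> dquat_degree (scalar p * h)"
    using c(2,3) assms(1) by (simp add: degree_mult_eq)
qed

section \<open>Primitive representatives of projective points\<close>

definition dq_dvd :: "'a::comm_ring_1 \<Rightarrow> 'a dquat \<Rightarrow> bool" where
  "dq_dvd p h \<longleftrightarrow> (\<exists>h'. h = scalar p * h')"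

lemma dq_dvd_iff:
  "dq_dvd p h \<longleftrightarrow>
     p dvd q0 (primal h) \<and> p dvd q1 (primal h) \<and> p dvd q2 (primal h) \<and> p dvd q3 (primal h) \<and>
     p dvd q0 (dual h) \<and> p dvd q1 (dual h) \<and> p dvd q2 (dual h) \<and> p dvd q3 (dual h)"
  (is "_ \<longleftrightarrow> ?R")
proof
  assume ?R
  then obtain a0 a1 a2 a3 d0 d1 d2 d3 where
    "q0 (primal h) = p * a0" "q1 (primal h) = p * a1" "q2 (primal h) = p * a2" "q3 (primal h) = p * a3"
    "q0 (dual h) = p * d0" "q1 (dual h) = p * d1" "q2 (dual h) = p * d2" "q3 (dual h) = p * d3"
    unfolding dvd_def by blast
  then show "dq_dvd p h"
    unfolding dq_dvd_def
    by (intro exI[of _ "DQ (Quat a0 a1 a2 a3) (Quat d0 d1 d2 d3)"])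
       (simp add: dquat_eq_iff quat_eq_iff)
qed (auto simp: dq_dvd_def)

definition dq_primitive :: "real poly dquat \<Rightarrow> bool" where
  "dq_primitive h \<longleftrightarrow> (\<forall>p. dq_dvd p h \<longrightarrow> is_unit p)"

lemma dq_primitive_nonzero:
  fixes h :: "real poly dquat"
  assumes "dq_primitive h" shows "h \<noteq> 0"
proof
  assume "h = 0"
  then have "dq_dvd 0 h" by (simp add: dq_dvd_iff)
  with assms show False by (auto simp: dq_primitive_def)
qed

lemma minimal_representative_primitive:
  assumes "of_polys h \<in> point x" "dquat_degree h = point_degree (point x)" "x \<noteq> 0"
  shows "dq_primitive h"
  unfolding dq_primitive_def
proof (intro allI impI)
  fix p assume "dq_dvd p h"
  then obtain h' where h': "h = scalar p * h'" by (auto simp: dq_dvd_def)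
  have "of_polys h \<noteq> 0"
    using assms(1,3) by (auto simp: point_def)
  then have nz: "p \<noteq> 0" "h' \<noteq> 0" using h' by auto
  have "point (of_polys h) = point (of_polys h')"
    unfolding point_eq_iff using nz(1) h'
    by (intro exI[of _ "to_fract p"]) (simp add: of_polys_mult of_polys_scalar)
  then have "of_polys h' \<in> point x"
    using assms(1) by (simp add: in_point_iff)
  then have "dquat_degree h \<le> dquat_degree h'"
    using assms(2) point_degree_le by metis
  then have "degree p = 0"
    using dquat_degree_scalar_mult[OF nz] h' by simp
  with nz(1) show "is_unit p" by (simp add: is_unit_iff_degree)
qed

text \<open>In lowest terms \<open>r = a / b\<close>, the denominator divides every coordinate of
  \<open>h\<close> and hence is a unit by primitivity.\<close>

lemma primitive_proportional:
  assumes "dq_primitive h" "of_polys h' = scalar r * of_polys h"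
  obtains p where "r = to_fract p" "h' = scalar p * h"
proof -
  define a b where "a = fst (quot_of_fract r)" and "b = snd (quot_of_fract r)"
  have r: "r = to_fract a / to_fract b" and b: "b \<noteq> 0" and cop: "coprime a b"
    unfolding a_def b_def
    by (simp_all add: coprime_quot_of_fract flip: Fract_conv_to_fract)
  have "of_polys (scalar b * h') = of_polys (scalar a * h)"
    using assms(2) b unfolding of_polys_mult of_polys_scalar
    by (simp add: r flip: mult.assoc scalar_mult)
  then have eq: "scalar b * h' = scalar a * h" by simp
  then have eqs:
      "b * q0 (primal h') = a * q0 (primal h)" "b * q1 (primal h') = a * q1 (primal h)"
      "b * q2 (primal h') = a * q2 (primal h)" "b * q3 (primal h') = a * q3 (primal h)"
      "b * q0 (dual h') = a * q0 (dual h)" "b * q1 (dual h') = a * q1 (dual h)"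
      "b * q2 (dual h') = a * q2 (dual h)" "b * q3 (dual h') = a * q3 (dual h)"
    by (simp_all only: scalar_mult_sel[symmetric])
  have "b dvd c" if "b * c' = a * c" for c c'
    using that cop by (metis coprime_commute coprime_dvd_mult_right_iff dvd_triv_left)
  from this[OF eqs(1)] this[OF eqs(2)] this[OF eqs(3)] this[OF eqs(4)]
    this[OF eqs(5)] this[OF eqs(6)] this[OF eqs(7)] this[OF eqs(8)]
  have "dq_dvd b h" by (simp add: dq_dvd_iff)
  then have "is_unit b" using assms(1) by (simp add: dq_primitive_def)
  then obtain b' where b': "b' * b = 1" by (metis dvd_def mult.commute)
  have "to_fract b' * to_fract b = 1" using b' by (simp flip: to_fract_mult)
  then have "r = to_fract (a * b')"
    using b by (simp add: r field_simps)
  moreover have "h' = scalar (b' * b) * h'" using b' by simp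
  then have "h' = scalar (a * b') * h"
    using eq by (simp add: scalar_mult mult.assoc mult.commute[of a])
  ultimately show ?thesis using that by blast
qed

text \<open>Every polynomial representative is a polynomial multiple of a primitive one, so the two
  descriptions of the degree agree.\<close>

lemma point_degree_primitive:
  assumes "dq_primitive h" "of_polys h \<in> point x"
  shows "point_degree (point x) = dquat_degree h"
proof (rule antisym[OF point_degree_le[OF assms(2)]])
  obtain h' where h': "of_polys h' \<in> point x" "dquat_degree h' = point_degree (point x)"
    by (rule minimal_representative)
  then have "of_polys h' \<in> point (of_polys h)"
    using assms(2) by (simp add: in_point_iff)
  then obtain r where "r \<noteq> 0" "of_polys h' = scalar r * of_polys h" by (auto simp: point_def)
  with primitive_proportional[OF assms(1)] obtain p where p: "h' = scalar p * h" "p \<noteq> 0"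
    by (metis to_fract_0)
  with dquat_degree_scalar_mult[OF p(2) dq_primitive_nonzero[OF assms(1)]] h'(2)
  show "dquat_degree h \<le> point_degree (point x)" by simp
qed

section \<open>Complex polynomials with real and imaginary part\<close>

definition cpoly :: "real poly \<Rightarrow> real poly \<Rightarrow> complex poly" where
  "cpoly a b = map_poly complex_of_real a + smult \<i> (map_poly complex_of_real b)"

definition pcnj :: "complex poly \<Rightarrow> complex poly" where
  "pcnj = map_poly cnj"

lemma coeff_cpoly [simp]: "coeff (cpoly a b) n = Complex (coeff a n) (coeff b n)"
  by (simp add: cpoly_def coeff_map_poly complex_eq_iff)

lemma coeff_pcnj [simp]: "coeff (pcnj z) n = cnj (coeff z n)"
  by (simp add: pcnj_def coeff_map_poly)

lemma cpoly_eq_iff [simp]: "cpoly a b = cpoly c d \<longleftrightarrow> a = c \<and> b = d"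
  by (auto simp: poly_eq_iff)

lemma cpoly_0 [simp]: "cpoly 0 0 = 0"
  and cpoly_1 [simp]: "cpoly 1 0 = 1"
  by (simp_all add: cpoly_def)

lemma cpoly_eq_0_iff [simp]: "cpoly a b = 0 \<longleftrightarrow> a = 0 \<and> b = 0"
  using cpoly_eq_iff[of a b 0 0] by (simp del: cpoly_eq_iff)

lemma cpoly_cases:
  fixes z :: "complex poly"
  obtains a b where "z = cpoly a b"
proof
  show "z = cpoly (map_poly Re z) (map_poly Im z)"
    by (simp add: poly_eq_iff coeff_map_poly)
qed

lemma cpoly_add: "cpoly a b + cpoly c d = cpoly (a + c) (b + d)"
  and cpoly_diff: "cpoly a b - cpoly c d = cpoly (a - c) (b - d)"
  and cpoly_minus: "- cpoly a b = cpoly (- a) (- b)"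
  by (simp_all add: poly_eq_iff complex_eq_iff)

lemma of_real_poly_mult:
  "map_poly complex_of_real (a * b) = map_poly complex_of_real a * map_poly complex_of_real b"
  by (simp add: poly_eq_iff coeff_map_poly coeff_mult)

lemma cpoly_mult: "cpoly a b * cpoly c d = cpoly (a * c - b * d) (a * d + b * c)"
proof -
  have hom: "map_poly complex_of_real (x + y) = map_poly complex_of_real x + map_poly complex_of_real y"
    "map_poly complex_of_real (x - y) = map_poly complex_of_real x - map_poly complex_of_real y" for x y
    by (simp_all add: poly_eq_iff coeff_map_poly)
  show ?thesis
    unfolding cpoly_def hom of_real_poly_mult by (simp add: algebra_simps smult_add_right)
qed

lemma pcnj_cpoly [simp]: "pcnj (cpoly a b) = cpoly a (- b)"
  by (simp add: poly_eq_iff complex_eq_iff)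

lemma pcnj_pcnj [simp]: "pcnj (pcnj z) = z"
  and pcnj_0 [simp]: "pcnj 0 = 0"
  and pcnj_1 [simp]: "pcnj 1 = 1"
  by (simp_all add: poly_eq_iff)

lemma pcnj_mult: "pcnj (y * z) = pcnj y * pcnj z"
  by (cases y rule: cpoly_cases; cases z rule: cpoly_cases) (simp add: cpoly_mult)

lemma pcnj_eq_0_iff [simp]: "pcnj z = 0 \<longleftrightarrow> z = 0"
  by (metis pcnj_0 pcnj_pcnj)

lemma degree_pcnj [simp]: "degree (pcnj z) = degree z"
  by (simp add: pcnj_def degree_map_poly)

lemma pcnj_dvd_iff [simp]: "pcnj y dvd pcnj z \<longleftrightarrow> y dvd z"
  by (metis dvd_def pcnj_mult pcnj_pcnj)

lemma degree_cpoly: "degree (cpoly a b) = max (degree a) (degree b)"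
proof (rule antisym)
  show "degree (cpoly a b) \<le> max (degree a) (degree b)"
    by (rule degree_le) (simp add: coeff_eq_0 complex_eq_iff)
  have "coeff a n = 0 \<and> coeff b n = 0" if "n > degree (cpoly a b)" for n
    using coeff_eq_0[OF that] by (simp add: complex_eq_iff)
  then show "max (degree a) (degree b) \<le> degree (cpoly a b)"
    by (simp add: degree_le)
qed

lemma degree_cpoly_le_iff: "degree (cpoly a b) \<le> n \<longleftrightarrow> degree a \<le> n \<and> degree b \<le> n"
  by (simp add: degree_cpoly)

lemma coprime_pcnj: "coprime a b \<Longrightarrow> coprime (pcnj a) (pcnj b)"
  unfolding coprime_def by (metis pcnj_1 pcnj_dvd_iff pcnj_pcnj)

lemma cpoly_real_dvd_iff: "cpoly p 0 dvd cpoly a b \<longleftrightarrow> p dvd a \<and> p dvd b"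
proof
  assume "cpoly p 0 dvd cpoly a b"
  then obtain z where "cpoly a b = cpoly p 0 * z" by (rule dvdE)
  then show "p dvd a \<and> p dvd b" by (cases z rule: cpoly_cases) (auto simp: cpoly_mult)
next
  assume "p dvd a \<and> p dvd b"
  then obtain c d where "a = p * c" "b = p * d" by (auto elim!: dvdE)
  then have "cpoly a b = cpoly p 0 * cpoly c d" by (simp add: cpoly_mult)
  then show "cpoly p 0 dvd cpoly a b" by simp
qed

section \<open>Quaternions as pairs of complex polynomials\<close>

text \<open>The pair \<open>(a, b)\<close> stands for \<open>A + i B\<close>, where \<open>A\<close> and \<open>B\<close> arise from \<open>a\<close> and \<open>b\<close> by
  replacing the imaginary unit by \<open>k\<close>; the sign in \<open>qsnd\<close> comes from \<open>i k = - j\<close>. Right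
  multiplication by \<open>\<real>[t] + \<real>[t] k\<close> becomes multiplication of pairs by complex polynomials.\<close>

definition qfst :: "real poly quat \<Rightarrow> complex poly" where
  "qfst x = cpoly (q0 x) (q3 x)"

definition qsnd :: "real poly quat \<Rightarrow> complex poly" where
  "qsnd x = cpoly (q1 x) (- q2 x)"

lemma qpair_eq_iff: "x = y \<longleftrightarrow> qfst x = qfst y \<and> qsnd x = qsnd y"
  by (auto simp: quat_eq_iff qfst_def qsnd_def)

lemma qpair_exists: "\<exists>x. qfst x = a \<and> qsnd x = b"
proof -
  obtain a0 a1 b0 b1 where "a = cpoly a0 a1" "b = cpoly b0 b1" by (metis cpoly_cases)
  then have "qfst (Quat a0 b0 (- b1) a1) = a \<and> qsnd (Quat a0 b0 (- b1) a1) = b"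
    by (simp add: qfst_def qsnd_def)
  then show ?thesis ..
qed

text \<open>Moving i past an element of \<real>[t] + \<real>[t] k conjugates that element, and the
  square of i is -1.\<close>

lemma qfst_mult: "qfst (x * y) = qfst x * qfst y - pcnj (qsnd x) * qsnd y"
  and qsnd_mult: "qsnd (x * y) = pcnj (qfst x) * qsnd y + qsnd x * qfst y"
  by (simp_all add: qfst_def qsnd_def cpoly_mult cpoly_add cpoly_diff cpoly_minus algebra_simps)

lemma qpair_add: "qfst (x + y) = qfst x + qfst y" "qsnd (x + y) = qsnd x + qsnd y"
  by (simp_all add: qfst_def qsnd_def cpoly_add)

lemma qpair_diff: "qfst (x - y) = qfst x - qfst y" "qsnd (x - y) = qsnd x - qsnd y"
  by (simp_all add: qfst_def qsnd_def cpoly_diff)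

text \<open>For the primal part \<open>x\<close> and the dual part \<open>y\<close> of a motion, the
  real part is the Study condition and the imaginary part is half the dual part of the
  trajectory.\<close>

lemma hermitian_eq:
  "pcnj (qfst x) * qfst y + pcnj (qsnd x) * qsnd y = cpoly (qinner x y) (qinner (x * qk) y)"
  by (simp add: qfst_def qsnd_def qinner_def cpoly_mult cpoly_add algebra_simps)

text \<open>The Hopf map in complex coordinates: first the k-component, then the other two
  components up to sign and order.\<close>

lemma qrot_qfst_qsnd:
  "pcnj (qfst x) * qfst x - pcnj (qsnd x) * qsnd x = cpoly (q3 (qrot x)) 0"
  "2 * (pcnj (qfst x) * qsnd x) = cpoly (- q2 (qrot x)) (- q1 (qrot x))"
  by (simp_all add: qfst_def qsnd_def qrot_sel cpoly_mult cpoly_diff cpoly_add mult_2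
      algebra_simps)

lemma qinner_self_qfst_qsnd:
  "pcnj (qfst x) * qfst x + pcnj (qsnd x) * qsnd x = cpoly (qinner x x) 0"
  by (simp add: qfst_def qsnd_def qinner_def cpoly_mult cpoly_add algebra_simps)

lemma quat_degree_qpair_le_iff:
  "quat_degree x \<le> n \<longleftrightarrow> degree (qfst x) \<le> n \<and> degree (qsnd x) \<le> n"
  by (auto simp: quat_degree_le_iff qfst_def qsnd_def degree_cpoly_le_iff)

lemma quat_degree_eq_max: "quat_degree x = max (degree (qfst x)) (degree (qsnd x))"
  by (rule antisym) (use quat_degree_qpair_le_iff[of x] in auto)

section \<open>Bezout equations with bounded degrees\<close>

lemma coprime_bezout:
  fixes a b :: "'a::euclidean_ring_gcd"
  assumes "coprime a b"
  obtains x y where "a * x + b * y = 1"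
  by (metis assms bezout_coefficients_fst_snd coprime_iff_gcd_eq_1 mult.commute)

text \<open>The common cofactor is \<open>x * s + y * t\<close> for Bezout coefficients
  \<open>s\<close>, \<open>t\<close> of \<open>a\<close>, \<open>b\<close>.\<close>

lemma proportional_to_coprime:
  fixes a b :: "'a::euclidean_ring_gcd"
  assumes "coprime a b" "x * b = y * a"
  obtains e where "x = a * e" "y = b * e"
proof -
  obtain s t where st: "a * s + b * t = 1" using assms(1) by (rule coprime_bezout)
  have "x = x * (a * s + b * t)" "y = y * (a * s + b * t)" by (simp_all add: st)
  then have "x = a * (x * s + y * t)" "y = b * (x * s + y * t)"
    using assms(2) by algebra+
  then show ?thesis by (rule that)
qed

text \<open>By symmetry let \<open>b\<close> have the larger degree \<open>q\<close>. The
  coefficient of \<open>a\<close> is reduced modulo \<open>b\<close>, to degree at most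
  \<open>q \<le> d - q\<close>; then \<open>b * y = f - a * x\<close> bounds the degree of
  \<open>y\<close>.\<close>

lemma bezout_with_degree_bound:
  fixes a b f :: "complex poly"
  assumes cop: "coprime a b" and q: "q = max (degree a) (degree b)"
    and d: "2 * q \<le> d" "degree f \<le> d"
  obtains x y where "a * x + b * y = f" "degree x \<le> d - q" "degree y \<le> d - q"
proof -
  have *: "\<exists>x y. a * x + b * y = f \<and> degree x \<le> d - q \<and> degree y \<le> d - q"
    if cop: "coprime a b" and a: "degree a \<le> q" and b: "degree b = q" for a b :: "complex poly"
  proof -
    obtain s t where st: "a * s + b * t = 1" using cop by (rule coprime_bezout)
    show ?thesis
    proof (cases "b = 0")
      \<comment> \<open>Here the larger degree is 0, so \<open>a\<close> is a nonzero constant and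
        \<open>y = 0\<close> works.\<close>
      case True
      with st b have "q = 0" "a * (s * f) = f" by (simp_all add: mult.assoc[symmetric])
      moreover have "a dvd 1" using st True by (metis add.right_neutral dvd_triv_left mult_zero_left)
      then have "a \<noteq> 0" by auto
      have "degree (s * f) \<le> degree (a * (s * f))"
        using degree_mult_eq[OF \<open>a \<noteq> 0\<close>, of "s * f"] by (cases "s * f = 0") auto
      with \<open>a * (s * f) = f\<close> have "degree (s * f) \<le> degree f" by (simp only:)
      with \<open>q = 0\<close> \<open>a * (s * f) = f\<close> d True show ?thesis
        by (intro exI[of _ "s * f"] exI[of _ 0]) auto
    next
      case False
      define x y where "x = (s * f) mod b" and "y = t * f + a * ((s * f) div b)"
      have eq: "a * x + b * y = f"
      proof -
        have "x + b * (s * f div b) = s * f" unfolding x_def by simp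
        then have "a * x + b * y = (a * s + b * t) * f" unfolding y_def by algebra
        then show ?thesis by (simp add: st)
      qed
      have x: "degree x \<le> q" "x \<noteq> 0 \<Longrightarrow> degree x < q"
        using degree_mod_less[OF False, of "s * f"] b by (auto simp: x_def)
      have "degree (b * y) \<le> d"
      proof -
        have "degree (a * x) \<le> d"
          using degree_mult_le[of a x] a x(1) d(1) by linarith
        moreover have "b * y = f - a * x" using eq by (simp add: algebra_simps)
        ultimately show ?thesis using d(2) by (simp add: degree_diff_le)
      qed
      then have "degree y \<le> d - q"
        using False b by (cases "y = 0") (simp_all add: degree_mult_eq)
      with eq x d(1) show ?thesis by (intro exI[of _ x] exI[of _ y]) auto
    qed
  qed
  show ?thesis
  proof (cases "degree b = q")
    case True
    moreover have "degree a \<le> q" using q by simp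
    ultimately show ?thesis using *[OF cop] that by metis
  next
    case False
    have "degree b \<le> q" "degree a = q" using q False by simp_all
    moreover have "coprime b a" using cop by (simp add: coprime_commute)
    ultimately obtain y x where "b * y + a * x = f" "degree y \<le> d - q" "degree x \<le> d - q"
      using *[of b a] by metis
    with that[of x y] show ?thesis by (simp add: add.commute)
  qed
qed

section \<open>Reduced form of kinematic torses\<close>

lemma degree_qinner_le:
  assumes "quat_degree x \<le> m" "quat_degree y \<le> n"
  shows "degree (qinner x y) \<le> m + n"
proof -
  have "degree (a * b) \<le> m + n" if "degree a \<le> m" "degree b \<le> n" for a b :: "real poly"
    using degree_mult_le[of a b] that by linarith
  then show ?thesis
    using assms unfolding qinner_def quat_degree_le_iff by (intro degree_add_le) auto
qed

lemma coeff_square: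
  fixes a :: "'a::comm_semiring_0 poly"
  assumes "degree a \<le> m"
  shows "coeff (a * a) (m + m) = coeff a m * coeff a m"
proof (cases "degree a = m")
  case True
  then show ?thesis using coeff_mult_degree_sum[of a a] by simp
next
  case False
  with assms have "degree (a * a) < m + m"
    using degree_mult_le[of a a] by linarith
  with False assms show ?thesis by (simp add: coeff_eq_0)
qed

text \<open>For positive degree, the coefficient at twice the degree is a sum of squares of real
  numbers that are not all zero, so leading terms cannot cancel.\<close>

lemma degree_qinner_self: "degree (qinner x x) = 2 * quat_degree x"
proof (rule antisym)
  show "degree (qinner x x) \<le> 2 * quat_degree x"
    using degree_qinner_le[of x "quat_degree x" x "quat_degree x"] by simp
  let ?m = "quat_degree x"
  show "2 * ?m \<le> degree (qinner x x)"
  proof (cases "?m = 0")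
    case False
    have le: "degree (q0 x) \<le> ?m" "degree (q1 x) \<le> ?m" "degree (q2 x) \<le> ?m" "degree (q3 x) \<le> ?m"
      using quat_degree_le_iff[of x ?m] by simp_all
    let ?a = "coeff (q0 x) ?m" and ?b = "coeff (q1 x) ?m"
      and ?c = "coeff (q2 x) ?m" and ?d = "coeff (q3 x) ?m"
    have coeff: "coeff (qinner x x) (?m + ?m) = ?a * ?a + ?b * ?b + ?c * ?c + ?d * ?d"
      using le by (simp add: qinner_def coeff_square)
    have "degree (q0 x) = ?m \<or> degree (q1 x) = ?m \<or> degree (q2 x) = ?m \<or> degree (q3 x) = ?m"
      unfolding quat_degree_def by (auto simp: max_def)
    then have "?a \<noteq> 0 \<or> ?b \<noteq> 0 \<or> ?c \<noteq> 0 \<or> ?d \<noteq> 0"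
      using False by (metis degree_0 leading_coeff_0_iff)
    then have "qinner (Quat ?a ?b ?c ?d) (Quat ?a ?b ?c ?d) \<noteq> 0"
      by (subst qinner_self_eq_0_iff) (auto simp: quat_eq_iff)
    then have "coeff (qinner x x) (?m + ?m) \<noteq> 0"
      using coeff by (simp add: qinner_def)
    then show ?thesis using le_degree[of "qinner x x" "?m + ?m"] by simp
  qed simp
qed

text \<open>The norm of the rotated vector is the square of the norm of \<open>x\<close>; comparing
  degrees gives the claim.\<close>

lemma quat_degree_qrot: "quat_degree (qrot x) = 2 * quat_degree x"
proof (cases "x = 0")
  case True
  then have "qrot x = x" by (simp add: qrot_def)
  with True show ?thesis by (simp add: quat_degree_def)
next
  case False
  have "2 * quat_degree (qrot x) = degree ((qinner x x)\<^sup>2)"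
    by (simp flip: degree_qinner_self qinner_qrot)
  also have "\<dots> = 2 * (2 * quat_degree x)"
    using False by (simp add: degree_power_eq degree_qinner_self)
  finally show ?thesis by simp
qed

text \<open>The ideal generated by the entries of \<open>x k x\<^sup>*\<close> and the norm contains the product of
  the ideals of \<open>(a, b)\<close> and of its conjugate, where \<open>(a, b)\<close> is the pair of \<open>x\<close>.\<close>

lemma dq_primitive_qrot:
  assumes "coprime (qfst x) (qsnd x)"
  shows "dq_primitive (DQ (qrot x) 0)"
  unfolding dq_primitive_def
proof (intro allI impI)
  fix p assume "dq_dvd p (DQ (qrot x) 0)"
  then have dvd: "p dvd q1 (qrot x)" "p dvd q2 (qrot x)" "p dvd q3 (qrot x)"
    by (simp_all add: dq_dvd_iff)
  let ?a = "qfst x" and ?b = "qsnd x" and ?p = "cpoly p 0"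
  \<comment> \<open>This norm is the square of the norm of \<open>x\<close>, and divisibility of
    squares descends to the bases.\<close>
  have "p\<^sup>2 dvd qinner (qrot x) (qrot x)"
    using dvd by (simp add: qinner_def qrot_sel(1) power2_eq_square mult_dvd_mono)
  then have "p dvd qinner x x" by (simp add: qinner_qrot)
  then have s: "?p dvd pcnj ?a * ?a + pcnj ?b * ?b"
    by (simp add: qinner_self_qfst_qsnd cpoly_real_dvd_iff)
  have d: "?p dvd pcnj ?a * ?a - pcnj ?b * ?b"
    using dvd by (simp add: qrot_qfst_qsnd cpoly_real_dvd_iff)
  have half: "z dvd w" if "z dvd 2 * w" for z w :: "complex poly"
  proof -
    have "z dvd smult (1/2) (2 * w)" using that by (rule dvd_smult)
    moreover have "smult (1/2) (2 * w) = w"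
      by (simp add: numeral_poly)
    ultimately show ?thesis by simp
  qed
  have "?p dvd 2 * (pcnj ?a * ?a)" "?p dvd 2 * (pcnj ?b * ?b)"
    using dvd_add[OF s d] dvd_diff[OF s d] by (simp_all add: algebra_simps)
  then have 1: "?p dvd pcnj ?a * ?a" "?p dvd pcnj ?b * ?b" by (auto dest: half)
  have 2: "?p dvd pcnj ?a * ?b"
    by (rule half) (use dvd in \<open>simp add: qrot_qfst_qsnd cpoly_real_dvd_iff\<close>)
  \<comment> \<open>The factor \<open>cpoly p 0\<close> is its own conjugate, so the other mixed
    product is divisible as well.\<close>
  then have "pcnj ?p dvd pcnj (pcnj ?a * ?b)" by (simp only: pcnj_dvd_iff)
  then have 3: "?p dvd ?a * pcnj ?b" by (simp add: pcnj_mult)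
  obtain s t where st: "?a * s + ?b * t = 1" using assms by (rule coprime_bezout)
  obtain s' t' where st': "pcnj ?a * s' + pcnj ?b * t' = 1"
    using coprime_pcnj[OF assms] by (rule coprime_bezout)
  have "1 = (?a * s + ?b * t) * (pcnj ?a * s' + pcnj ?b * t')" by (simp add: st st')
  also have "\<dots> = pcnj ?a * ?a * (s * s') + pcnj ?b * ?b * (t * t')
      + pcnj ?a * ?b * (s' * t) + ?a * pcnj ?b * (s * t')"
    by algebra
  also have "?p dvd \<dots>"
    by (intro dvd_add 1[THEN dvd_mult2] 2[THEN dvd_mult2] 3[THEN dvd_mult2])
  finally have "?p dvd cpoly 1 0" by simp
  then show "is_unit p" unfolding cpoly_real_dvd_iff by simp
qed

text \<open>Since \<open>c + d k\<close> commutes with k, only its norm survives.\<close>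

lemma qrot_mult_planar:
  "q1 (qrot (x * Quat c 0 0 d)) = (c * c + d * d) * q1 (qrot x)"
  "q2 (qrot (x * Quat c 0 0 d)) = (c * c + d * d) * q2 (qrot x)"
  "q3 (qrot (x * Quat c 0 0 d)) = (c * c + d * d) * q3 (qrot x)"
  by (simp_all add: qrot_sel algebra_simps)

lemma qpair_planar [simp]: "qfst (Quat c 0 0 d) = cpoly c d" "qsnd (Quat c 0 0 d) = 0"
  by (simp_all add: qfst_def qsnd_def)

text \<open>If \<open>v\<close> has norm \<open>w\<^sup>2\<close>, then \<open>x\<^sub>0 = w - v k\<close> satisfies \<open>v x\<^sub>0 = w x\<^sub>0 k\<close> and hence
  rotates \<open>k\<close> into a multiple of \<open>v\<close>. Removing the gcd of its pair, i.e. the largest right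
  factor in \<open>\<real>[t] + \<real>[t] k\<close>, makes it reduced.\<close>

lemma pythagorean_parametrization:
  fixes v1 v2 v3 w :: "real poly"
  assumes norm: "v1 * v1 + v2 * v2 + v3 * v3 = w * w" and nz: "v1 \<noteq> 0 \<or> v2 \<noteq> 0 \<or> v3 \<noteq> 0"
  obtains x c b where "coprime (qfst x) (qsnd x)" "c \<noteq> 0" "b \<noteq> 0"
    "c * v1 = b * q1 (qrot x)" "c * v2 = b * q2 (qrot x)" "c * v3 = b * q3 (qrot x)"
proof -
  \<comment> \<open>The scalar part of \<open>w - v k\<close> is \<open>w + v3\<close>. The sign of
    \<open>w\<close> is chosen to keep it nonzero; if both signs failed, \<open>w\<close> and then
    the whole vector would vanish.\<close>
  obtain w' where w': "w' * w' = w * w" "w' + v3 \<noteq> 0"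
  proof (cases "w + v3 = 0 \<and> - w + v3 = 0")
    case True
    then have "v3 + v3 = 0" by algebra
    then have "v3 = 0" by (simp flip: mult_2)
    with True have "w = 0" by simp
    with norm \<open>v3 = 0\<close> have "qinner (Quat 0 v1 v2 v3) (Quat 0 v1 v2 v3) = 0"
      by (simp add: qinner_def)
    with nz have False by (simp only: qinner_self_eq_0_iff) (simp add: quat_eq_iff)
    then show ?thesis ..
  next
    case False
    then show ?thesis using that[of w] that[of "- w"] by auto
  qed
  \<comment> \<open>The pair of \<open>w' - v k\<close>.\<close>
  let ?a0 = "cpoly (w' + v3) 0" and ?b0 = "cpoly (- v2) (- v1)"
  have g0: "gcd ?a0 ?b0 \<noteq> 0" using w'(2) by simp
  obtain a b where ab: "?a0 = a * gcd ?a0 ?b0" "?b0 = b * gcd ?a0 ?b0" "coprime a b"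
    using gcd_coprime_exists[OF g0] by blast
  obtain g1 g2 where g: "gcd ?a0 ?b0 = cpoly g1 g2" by (metis cpoly_cases)
  obtain x where x: "qfst x = a" "qsnd x = b" using qpair_exists by blast
  have "x * Quat g1 0 0 g2 = Quat (w' + v3) (- v2) v1 0"
    using ab g unfolding qpair_eq_iff by (simp add: qfst_mult qsnd_mult x) (simp add: qfst_def qsnd_def)
  then have "qrot (x * Quat g1 0 0 g2) = qrot (Quat (w' + v3) (- v2) v1 0)" by simp
  \<comment> \<open>The element \<open>w' - v k\<close> rotates k into \<open>2 * (w' + v3)\<close>
    times the vector; splitting off the gcd contributes its norm
    \<open>g1 * g1 + g2 * g2\<close>.\<close>
  from qrot_mult_planar[of x g1 g2, unfolded this] norm w'(1)
  have eq: "2 * (w' + v3) * v1 = (g1 * g1 + g2 * g2) * q1 (qrot x)"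
    "2 * (w' + v3) * v2 = (g1 * g1 + g2 * g2) * q2 (qrot x)"
    "2 * (w' + v3) * v3 = (g1 * g1 + g2 * g2) * q3 (qrot x)"
    unfolding qrot_sel(2-4)[of "Quat (w' + v3) (- v2) v1 0"] quat.sel by algebra+
  have "qinner (Quat g1 0 0 g2) (Quat g1 0 0 g2) \<noteq> 0"
    using g0 g by (subst qinner_self_eq_0_iff) (auto simp: quat_eq_iff)
  then have "g1 * g1 + g2 * g2 \<noteq> 0" by (simp add: qinner_def)
  moreover have "2 * (w' + v3) \<noteq> 0" using w'(2) by simp
  ultimately show ?thesis
    using that[of x] ab(3) x eq by blast
qed

section \<open>The reduced normal form of a kinematic torse\<close>

definition torse :: "real poly \<Rightarrow> real poly quat \<Rightarrow> real poly \<Rightarrow> real poly dquat" where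
  "torse g x v = DQ (Quat g 0 0 0 * qrot x) (Quat v 0 0 0)"

lemma torse_sel [simp]:
  "primal (torse g x v) = Quat g 0 0 0 * qrot x" "dual (torse g x v) = Quat v 0 0 0"
  by (simp_all add: torse_def)

lemma dquat_degree_torse:
  assumes "g \<noteq> 0" "x \<noteq> 0"
  shows "dquat_degree (torse g x v) = max (degree g + 2 * quat_degree x) (degree v)"
proof -
  have "qrot x \<noteq> 0"
    using assms(2) qinner_qrot[of x] by (auto simp: qinner_def[of 0 0])
  then have "dquat_degree (scalar g * DQ (qrot x) 0) = degree g + dquat_degree (DQ (qrot x) 0)"
    using assms(1) by (subst dquat_degree_scalar_mult) (auto simp: dquat_eq_iff)
  moreover have "scalar g * DQ (qrot x) 0 = DQ (Quat g 0 0 0 * qrot x) 0"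
    by (simp add: dquat_eq_iff)
  ultimately have "quat_degree (Quat g 0 0 0 * qrot x) = degree g + 2 * quat_degree x"
    by (simp add: dquat_degree_def quat_degree_qrot)
  then show ?thesis
    by (simp add: dquat_degree_def)
qed

lemma map_quat_to_fract_qinner: "qinner (map_quat to_fract x) (map_quat to_fract y) = to_fract (qinner x y)"
  by (simp add: qinner_def)

text \<open>A primitive representative of the torse has a vector part proportional to the primitive
  vector \<open>qrot x\<close>, which yields a polynomial factor \<open>g\<close>; primitivity makes
  \<open>g\<close> and \<open>v\<close> coprime. The Gauss map is represented by the norm of
  \<open>x\<close>, up to sign, together with \<open>qrot x\<close>.\<close>

lemma torse_normal_form:
  assumes "rational_kinematic_torse u" and "gauss_map u n"
  obtains g x v where "coprime (qfst x) (qsnd x)" "g \<noteq> 0" "coprime g v"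
    "point u = point (of_polys (torse g x v))" "dq_primitive (torse g x v)"
    "point_degree (point u) = dquat_degree (torse g x v)"
    "point_degree (point n) = 2 * quat_degree x"
proof -
  from assms(1) obtain z where u: "plane_form u" and z: "kinematic_plane_poly z"
    and zu: "point (of_polys z) = point u"
    by (auto simp: rational_kinematic_torse_def)
  from assms(2) obtain w where pu: "primal u \<noteq> 0" and w: "dnorm u = scalar (w\<^sup>2)"
    and n: "n = DQ (Quat w 0 0 0) (primal u)"
    by (auto simp: gauss_map_def)
  obtain s where s: "s \<noteq> 0" "u = scalar s * of_polys z"
    using zu[symmetric] by (auto simp: point_eq_iff)
  from z obtain \<omega> where "dnorm z = scalar (\<omega>\<^sup>2)" "plane_form z"
    by (auto simp: kinematic_plane_poly_def)
  then have z_norm: "q1 (primal z) * q1 (primal z) + q2 (primal z) * q2 (primal z)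
      + q3 (primal z) * q3 (primal z) = \<omega> * \<omega>" and z0: "q0 (primal z) = 0"
    by (auto simp: dnorm_eq dquat_eq_iff quat_eq_iff qinner_def plane_form_def power2_eq_square)
  have "q1 (primal z) \<noteq> 0 \<or> q2 (primal z) \<noteq> 0 \<or> q3 (primal z) \<noteq> 0"
    using pu s z0 by (auto simp: quat_eq_iff)
  then obtain x c b where cop: "coprime (qfst x) (qsnd x)" and cb: "c \<noteq> 0" "b \<noteq> 0"
    and cz: "c * q1 (primal z) = b * q1 (qrot x)" "c * q2 (primal z) = b * q2 (qrot x)"
      "c * q3 (primal z) = b * q3 (qrot x)"
    using pythagorean_parametrization[OF z_norm] by metis
  \<comment> \<open>The rational factor between the vector part of \<open>u\<close> and
    \<open>qrot x\<close>.\<close>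
  define \<kappa> where "\<kappa> = s * to_fract b / to_fract c"
  have \<kappa>: "\<kappa> \<noteq> 0" using s cb by (simp add: \<kappa>_def)
  have \<kappa>eq: "s * to_fract a = \<kappa> * to_fract a'" if "c * a = b * a'" for a a'
  proof -
    have "to_fract c * to_fract a = to_fract b * to_fract a'"
      using that by (simp flip: to_fract_mult)
    then show ?thesis using cb by (simp add: \<kappa>_def field_simps)
  qed
  have pu_eq: "primal u = Quat \<kappa> 0 0 0 * map_quat to_fract (qrot x)"
    using \<kappa>eq[OF cz(1)] \<kappa>eq[OF cz(2)] \<kappa>eq[OF cz(3)]
    by (simp add: quat_eq_iff s(2) z0 qrot_sel(1))

  obtain h where h: "of_polys h \<in> point u" "dquat_degree h = point_degree (point u)"
    by (rule minimal_representative)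
  have "u \<noteq> 0" using pu by auto
  with h have h_prim: "dq_primitive h" by (rule minimal_representative_primitive)
  obtain r where r: "r \<noteq> 0" "of_polys h = scalar r * u"
    using h(1) by (auto simp: point_def)
  have "of_polys (DQ (primal h) 0) = scalar (r * \<kappa>) * of_polys (DQ (qrot x) 0)"
  proof -
    have "primal (of_polys h) = primal (scalar r * u)" by (simp only: r(2))
    then show ?thesis
      by (simp add: dquat_eq_iff quat_eq_iff pu_eq)
  qed
  with dq_primitive_qrot[OF cop] obtain g where
    g: "r * \<kappa> = to_fract g" "DQ (primal h) 0 = scalar g * DQ (qrot x) 0"
    by (rule primitive_proportional)
  have "g \<noteq> 0" using g(1) r(1) \<kappa> by auto
  define v where "v = q0 (dual h)"
  have "dual (of_polys h) = dual (scalar r * u)" by (simp only: r(2))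
  with u have "dual h = Quat v 0 0 0"
    by (simp add: v_def quat_eq_iff plane_form_def)
  with g(2) have h_eq: "h = torse g x v" by (simp add: dquat_eq_iff)
  have "coprime g v"
  proof (rule coprimeI)
    fix p assume "p dvd g" "p dvd v"
    then have "dq_dvd p h" unfolding h_eq dq_dvd_iff by simp
    then show "is_unit p" using h_prim by (simp add: dq_primitive_def)
  qed

  have "w\<^sup>2 = (\<kappa> * to_fract (qinner x x))\<^sup>2"
  proof -
    have "w\<^sup>2 = qinner (primal u) (primal u)"
      using w by (simp add: dnorm_eq dquat_eq_iff quat_eq_iff)
    also have "\<dots> = \<kappa>\<^sup>2 * to_fract (qinner (qrot x) (qrot x))"
      by (simp add: pu_eq qinner_def power2_eq_square algebra_simps)
    finally show ?thesis by (simp add: qinner_qrot power2_eq_square mult_ac)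
  qed
  \<comment> \<open>The square root in the Gauss map is determined up to the sign
    \<open>\<sigma>\<close>.\<close>
  then obtain \<sigma> where \<sigma>: "\<sigma> = 1 \<or> \<sigma> = -1" "w = \<kappa> * to_fract (\<sigma> * qinner x x)"
    unfolding power2_eq_iff by (metis mult_1 mult_minus1 mult_minus_right to_fract_uminus)
  define m where "m = DQ (Quat (\<sigma> * qinner x x) 0 0 0) (qrot x)"
  have "of_polys m \<in> point n"
    using \<kappa> unfolding in_point_iff point_eq_iff
    by (intro exI[of _ "inverse \<kappa>"]) (simp add: n m_def \<sigma>(2) pu_eq dquat_eq_iff quat_eq_iff)
  moreover have "dq_primitive m"
    using dq_primitive_qrot[OF cop] by (auto simp: dq_primitive_def dq_dvd_iff m_def)
  ultimately have "point_degree (point n) = dquat_degree m"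
    by (intro point_degree_primitive)
  also have "degree (\<sigma> * qinner x x) = 2 * quat_degree x"
    using \<sigma>(1) by (auto simp: degree_qinner_self)
  then have "dquat_degree m = 2 * quat_degree x"
    by (simp add: m_def dquat_degree_def quat_degree_qrot)
  finally have "point_degree (point n) = 2 * quat_degree x" .
  moreover have "point u = point (of_polys h)" using h(1) by (simp add: in_point_iff)
  ultimately show ?thesis
    using that[of x g v] cop \<open>g \<noteq> 0\<close> \<open>coprime g v\<close> h(2) h_prim unfolding h_eq by simp
qed

section \<open>Motions with a given trajectory\<close>

lemma cpoly_cnj_mult: "pcnj (cpoly a b) * cpoly a b = cpoly (a * a + b * b) 0"
  by (simp add: cpoly_mult)

lemma cpoly_real_mult: "cpoly a 0 * cpoly b c = cpoly (a * b) (a * c)"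
  by (simp add: cpoly_mult)

lemma qpair_right_planar:
  assumes "qfst y = qfst x * cpoly c d" "qsnd y = qsnd x * cpoly c d"
  shows "y = x * Quat c 0 0 d"
  using assms by (simp add: qpair_eq_iff qfst_mult qsnd_mult)

text \<open>Right multiplication by \<open>c + d k\<close> multiplies both entries of the pair by
  the same complex polynomial.\<close>

lemma quat_degree_mult_planar:
  assumes "x \<noteq> 0" "cpoly c d \<noteq> 0"
  shows "quat_degree (x * Quat c 0 0 d) = quat_degree x + degree (cpoly c d)"
proof -
  have *: "degree (a * cpoly c d) = (if a = 0 then 0 else degree a + degree (cpoly c d))" for a
    using degree_mult_eq[OF _ assms(2)] by simp
  have nz: "qfst x \<noteq> 0 \<or> qsnd x \<noteq> 0"
    using assms(1) by (auto simp: quat_eq_iff qfst_def qsnd_def)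
  then show ?thesis
    using * by (auto simp: quat_degree_eq_max qfst_mult qsnd_mult max_def)
qed

text \<open>Together with the Study condition \<open>\<langle>x, y\<rangle> = 0\<close> this prescribes the Hermitian product
  of \<open>x\<close> and \<open>y\<close>, which is a Bezout equation.\<close>

lemma exists_dual_part:
  assumes "coprime (qfst x) (qsnd x)" "2 * quat_degree x \<le> d" "degree v \<le> d"
  obtains y where "qinner x y = 0" "2 * qinner (x * qk) y = v" "quat_degree y \<le> d - quat_degree x"
proof -
  \<comment> \<open>Real part 0 encodes the Study condition; the factor 1/2 cancels the 2 in the
    trajectory.\<close>
  let ?f = "cpoly 0 (smult (1/2) v)"
  have "degree ?f \<le> d" using assms(3) by (simp add: degree_cpoly)
  moreover have "quat_degree x = max (degree (pcnj (qfst x))) (degree (pcnj (qsnd x)))"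
    by (simp add: quat_degree_eq_max)
  ultimately obtain a b where ab: "pcnj (qfst x) * a + pcnj (qsnd x) * b = ?f"
      "degree a \<le> d - quat_degree x" "degree b \<le> d - quat_degree x"
    using bezout_with_degree_bound[OF coprime_pcnj[OF assms(1)], of "quat_degree x" d ?f] assms(2)
    by blast
  obtain y where y: "qfst y = a" "qsnd y = b" using qpair_exists by blast
  have "cpoly (qinner x y) (qinner (x * qk) y) = ?f"
    using ab(1) hermitian_eq[of x y] by (simp add: y)
  then have "qinner x y = 0" "qinner (x * qk) y = smult (1/2) v" by simp_all
  moreover have "2 * smult (1/2) v = v" by (simp add: numeral_poly)
  ultimately show ?thesis
    using that[of y] ab(2,3) y by (simp add: quat_degree_qpair_le_iff)
qed

lemma rational_motion_iff:
  "rational_motion C \<longleftrightarrow> primal C \<noteq> 0 \<and> qinner (primal C) (dual C) = 0"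
  by (auto simp: rational_motion_def study_eq quat_eq_iff)

lemma rational_motion_of_polys:
  "rational_motion (of_polys C) \<longleftrightarrow> primal C \<noteq> 0 \<and> qinner (primal C) (dual C) = 0"
  by (auto simp: rational_motion_iff map_quat_to_fract_qinner quat_eq_iff)

lemma trajectory_of_polys:
  "eps_cnj (of_polys C) * dq_k * dcnj (of_polys C) = of_polys (eps_cnj C * dq_k * dcnj C)"
  by (simp only: of_polys_mult of_polys_dcnj of_polys_eps_cnj of_polys_dq_k)

lemma has_trajectory_of_polys:
  assumes "point u = point (of_polys v)" "r \<noteq> 0" "eps_cnj C * dq_k * dcnj C = scalar r * v"
  shows "has_trajectory (of_polys C) u"
proof -
  have "point (scalar (to_fract r) * of_polys v) = point (of_polys v)"
    using assms(2) unfolding point_eq_iff by (intro exI[of _ "to_fract r"]) simp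
  then show ?thesis
    using assms by (simp add: has_trajectory_def trajectory_of_polys of_polys_mult of_polys_scalar)
qed

text \<open>Primitivity of \<open>v\<close> turns the rational proportionality factor into a
  polynomial.\<close>

lemma has_trajectory_of_polysD:
  assumes "point u = point (of_polys v)" "dq_primitive v" "has_trajectory (of_polys C) u"
  obtains r where "r \<noteq> 0" "eps_cnj C * dq_k * dcnj C = scalar r * v"
proof -
  have "point (of_polys (eps_cnj C * dq_k * dcnj C)) = point (of_polys v)"
    using assms(1,3) by (simp add: has_trajectory_def trajectory_of_polys)
  then obtain s where s: "s \<noteq> 0" "of_polys (eps_cnj C * dq_k * dcnj C) = scalar s * of_polys v"
    by (auto simp: point_eq_iff)
  with primitive_proportional[OF assms(2)] that show ?thesis by (metis to_fract_0)
qed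

lemma rational_motion_scalar:
  assumes "r \<noteq> 0" "rational_motion C"
  shows "rational_motion (scalar r * C)"
proof -
  have "qinner (primal (scalar r * C)) (dual (scalar r * C)) = r * r * qinner (primal C) (dual C)"
    by (simp add: qinner_def algebra_simps)
  with assms show ?thesis by (auto simp: rational_motion_iff quat_eq_iff)
qed

lemma trajectory_scalar:
  "eps_cnj (scalar r * C) * dq_k * dcnj (scalar r * C) =
     scalar (r * r) * (eps_cnj C * dq_k * dcnj C)"
  unfolding trajectory_eq by (simp add: dquat_eq_iff quat_eq_iff qrot_sel qinner_def algebra_simps)

lemma point_scalar [simp]: "r \<noteq> 0 \<Longrightarrow> point (scalar r * x) = point x"
  unfolding point_eq_iff by blast

lemma motion_representative:
  assumes "rational_motion C" "has_trajectory C u" "of_polys h \<in> point C"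
  shows "rational_motion (of_polys h)" "has_trajectory (of_polys h) u"
proof -
  obtain r where "r \<noteq> 0" "of_polys h = scalar r * C"
    using assms(3) by (auto simp: point_def)
  with assms(1,2) show "rational_motion (of_polys h)" "has_trajectory (of_polys h) u"
    by (simp_all add: rational_motion_scalar has_trajectory_def trajectory_scalar)
qed

lemma mult_dq_i_sel:
  "primal (C * dq_i) = primal C * Quat 0 1 0 0" "dual (C * dq_i) = dual C * Quat 0 1 0 0"
  by (simp_all add: dq_i_def)

lemma quat_degree_mult_i: "quat_degree (y * Quat 0 1 0 0) = quat_degree y"
proof -
  have "quat_degree (y * Quat 0 1 0 0) \<le> n \<longleftrightarrow> quat_degree y \<le> n" for n
    by (auto simp: quat_degree_le_iff)
  then show ?thesis by (metis order_antisym order_refl)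
qed

lemma dquat_degree_mult_dq_i: "dquat_degree (C * dq_i) = dquat_degree C"
  by (simp only: dquat_degree_def mult_dq_i_sel quat_degree_mult_i)

lemma qinner_mult_right: "qinner (x * z) (y * z) = qinner z z * qinner x y"
  by (simp add: qinner_def algebra_simps)

text \<open>The hypotheses determine all Hermitian products of the entries of the pair of
  \<open>p\<close>, so this pair is proportional to that of \<open>x\<close>, by a polynomial
  because of coprimality. The norm equation fixes the sign; the opposite sign would bring in a
  further right factor i.\<close>

lemma qrot_proportional:
  assumes cop: "coprime (qfst x) (qsnd x)"
    and rot: "qrot p = Quat s 0 0 0 * qrot x" and norm: "qinner p p = s * qinner x x"
  obtains c d where "p = x * Quat c 0 0 d" "c * c + d * d = s"
proof -
  let ?a = "qfst p" and ?b = "qsnd p" and ?\<alpha> = "qfst x" and ?\<beta> = "qsnd x" and ?s = "cpoly s 0"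
  have *: "pcnj ?a * ?a - pcnj ?b * ?b = ?s * (pcnj ?\<alpha> * ?\<alpha> - pcnj ?\<beta> * ?\<beta>)"
    "2 * (pcnj ?a * ?b) = ?s * (2 * (pcnj ?\<alpha> * ?\<beta>))"
    "pcnj ?a * ?a + pcnj ?b * ?b = ?s * (pcnj ?\<alpha> * ?\<alpha> + pcnj ?\<beta> * ?\<beta>)"
    unfolding qrot_qfst_qsnd qinner_self_qfst_qsnd rot norm
    by (simp_all add: cpoly_real_mult qrot_sel(1))
  have "2 * (pcnj ?a * ?a) = 2 * (?s * (pcnj ?\<alpha> * ?\<alpha>))"
    "2 * (pcnj ?b * ?b) = 2 * (?s * (pcnj ?\<beta> * ?\<beta>))"
    using *(1,3) by algebra+
  then have aa: "pcnj ?a * ?a = ?s * (pcnj ?\<alpha> * ?\<alpha>)" and bb: "pcnj ?b * ?b = ?s * (pcnj ?\<beta> * ?\<beta>)"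
    by simp_all
  have "2 * (pcnj ?a * ?b) = 2 * (?s * (pcnj ?\<alpha> * ?\<beta>))" using *(2) by (simp add: mult_ac)
  then have ab: "pcnj ?a * ?b = ?s * (pcnj ?\<alpha> * ?\<beta>)" by simp
  have "?a * ?\<beta> = ?b * ?\<alpha>"
  proof (cases "?a = 0")
    case True
    with aa bb ab have "?s = 0 \<or> ?\<alpha> = 0" by auto
    with bb True show ?thesis by auto
  next
    case False
    have "pcnj ?a * (?a * ?\<beta>) = pcnj ?a * (?b * ?\<alpha>)" using aa ab by algebra
    with False show ?thesis by simp
  qed
  with cop obtain e where e: "?a = ?\<alpha> * e" "?b = ?\<beta> * e" by (rule proportional_to_coprime)
  obtain c d where cd: "e = cpoly c d" by (metis cpoly_cases)
  have "x \<noteq> 0" using cop by (auto simp: qfst_def qsnd_def)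
  have p: "p = x * Quat c 0 0 d"
    using e unfolding cd by (rule qpair_right_planar)
  have "qinner p p = (c * c + d * d) * qinner x x"
    by (simp add: p qinner_def algebra_simps)
  with norm \<open>x \<noteq> 0\<close> have "c * c + d * d = s" by simp
  with p show ?thesis by (rule that)
qed

section \<open>Polynomial motions of a reduced torse\<close>

locale reduced_torse =
  fixes g v :: "real poly" and x :: "real poly quat"
  assumes coprime_pair: "coprime (qfst x) (qsnd x)"
    and g_nonzero: "g \<noteq> 0" and coprime_gv: "coprime g v"
begin

lemma x_nonzero: "x \<noteq> 0"
  using coprime_pair by (auto simp: qfst_def qsnd_def)

text \<open>The polynomial \<open>r\<close> records the scaling between the trajectory of
  \<open>C\<close> and the reduced torse, which projective equality forgets.\<close>

definition has_factor :: "real poly \<Rightarrow> real poly dquat \<Rightarrow> bool" where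
  "has_factor r C \<longleftrightarrow> r \<noteq> 0 \<and> qinner (primal C) (dual C) = 0 \<and>
     eps_cnj C * dq_k * dcnj C = scalar r * torse g x v"

lemma has_factor_iff:
  "has_factor r C \<longleftrightarrow> r \<noteq> 0 \<and> qinner (primal C) (dual C) = 0 \<and>
     qrot (primal C) = Quat (r * g) 0 0 0 * qrot x \<and> 2 * qinner (primal C * qk) (dual C) = r * v"
  unfolding has_factor_def trajectory_eq
  by (auto simp: dquat_eq_iff quat_eq_iff qrot_sel(1) mult.assoc)

text \<open>The two signs of \<open>N P = \<plusminus> r g N x\<close> are exchanged by the half turn \<open>i\<close>.\<close>

lemma oriented_representative:
  assumes "has_factor r C"
  obtains C' r' where "has_factor r' C'" "qinner (primal C') (primal C') = r' * g * qinner x x"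
    "C' = C \<or> C' = C * dq_i"
proof -
  \<comment> \<open>Take norms on both sides of the rotation equation.\<close>
  have "(qinner (primal C) (primal C))\<^sup>2 = (r * g * qinner x x)\<^sup>2"
  proof -
    have "(qinner (primal C) (primal C))\<^sup>2 = (r * g)\<^sup>2 * qinner (qrot x) (qrot x)"
      using assms unfolding has_factor_iff qinner_qrot[symmetric]
      by (simp add: qinner_def power2_eq_square algebra_simps)
    then show ?thesis by (simp add: qinner_qrot power_mult_distrib)
  qed
  then consider "qinner (primal C) (primal C) = r * g * qinner x x"
    | "qinner (primal C) (primal C) = - (r * g * qinner x x)"
    unfolding power2_eq_iff by blast
  then show ?thesis
  proof cases
    case 1
    with assms that show ?thesis by blast
  next
    case 2
    let ?i = "Quat 0 1 0 0 :: real poly quat"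
    have rot: "qrot (y * ?i) = - qrot y" for y
      by (simp add: quat_eq_iff qrot_sel)
    have k: "qinner (y * ?i * qk) (z * ?i) = - qinner (y * qk) z" for y z
      by (simp add: qinner_def)
    have i: "qinner (y * ?i) (z * ?i) = qinner y z" for y z
      by (simp add: qinner_mult_right) (simp add: qinner_def)
    have "has_factor (- r) (C * dq_i)"
      using assms unfolding has_factor_iff mult_dq_i_sel rot k i by (simp add: quat_eq_iff)
    moreover have "qinner (primal (C * dq_i)) (primal (C * dq_i)) = - r * g * qinner x x"
      unfolding mult_dq_i_sel i using 2 by simp
    ultimately show ?thesis using that by blast
  qed
qed

text \<open>Write the primal part as \<open>x * e\<close> with \<open>e = c + d k\<close>. The
  conjugate of \<open>e\<close> divides the norm \<open>r * g\<close> of \<open>e\<close>; it also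
  splits off the Hermitian product with the dual part and so divides \<open>r * v\<close>.
  Coprimality of \<open>g\<close> and \<open>v\<close> leaves \<open>r\<close>.\<close>

lemma oriented_factorization:
  assumes C: "has_factor r C" and norm: "qinner (primal C) (primal C) = r * g * qinner x x"
  obtains c d where "primal C = x * Quat c 0 0 d" "c * c + d * d = r * g"
    "pcnj (cpoly c d) * cpoly (qinner x (dual C)) (qinner (x * qk) (dual C)) = cpoly 0 (smult (1/2) (r * v))"
    "pcnj (cpoly c d) dvd cpoly r 0"
proof -
  have rot: "qrot (primal C) = Quat (r * g) 0 0 0 * qrot x" and study: "qinner (primal C) (dual C) = 0"
    and dual: "2 * qinner (primal C * qk) (dual C) = r * v"
    using C by (auto simp: has_factor_iff)
  obtain c d where p: "primal C = x * Quat c 0 0 d" and cd: "c * c + d * d = r * g"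
    using qrot_proportional[OF coprime_pair rot norm] by blast
  let ?e = "cpoly c d" and ?D = "dual C"
  have "pcnj ?e * cpoly (qinner x ?D) (qinner (x * qk) ?D) =
      pcnj (qfst (primal C)) * qfst ?D + pcnj (qsnd (primal C)) * qsnd ?D"
    by (simp add: p qfst_mult qsnd_mult pcnj_mult algebra_simps flip: hermitian_eq)
  also have "\<dots> = cpoly 0 (qinner (primal C * qk) ?D)"
    by (simp only: hermitian_eq study)
  also have "qinner (primal C * qk) ?D = smult (1/2) (2 * qinner (primal C * qk) ?D)"
    by (simp add: numeral_poly)
  finally have h: "pcnj ?e * cpoly (qinner x ?D) (qinner (x * qk) ?D) = cpoly 0 (smult (1/2) (r * v))"
    by (simp only: dual)
  \<comment> \<open>The unit \<open>-2i\<close> turns the imaginary right side of \<open>h\<close>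
    into the real polynomial \<open>r * v\<close>.\<close>
  have "cpoly (r * v) 0 = cpoly 0 (smult (1/2) (r * v)) * cpoly 0 (- 2)"
    by (simp add: cpoly_mult numeral_poly)
  then have rv: "pcnj ?e dvd cpoly (r * v) 0"
    unfolding h[symmetric] by (simp add: mult.assoc)
  have rg: "pcnj ?e dvd cpoly (r * g) 0"
    by (simp flip: cd cpoly_cnj_mult del: pcnj_cpoly)
  obtain s t where "g * s + v * t = 1" using coprime_gv by (rule coprime_bezout)
  then have "r = r * g * s + r * v * t" by algebra
  then have "cpoly r 0 = cpoly (r * g) 0 * cpoly s 0 + cpoly (r * v) 0 * cpoly t 0"
    by (simp add: cpoly_real_mult cpoly_add)
  with rv rg have "pcnj ?e dvd cpoly r 0" by simp
  with p cd h show ?thesis by (rule that)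
qed

text \<open>Divisibility gives \<open>deg e \<le> deg r\<close> and the norm gives
  \<open>2 deg e = deg r + deg g\<close>, hence \<open>deg g \<le> deg e\<close>, which bounds the
  primal part. Comparing degrees in the Hermitian equation bounds the dual part.\<close>

lemma degree_lower_bound:
  assumes C: "has_factor r C"
  shows "max (degree g + 2 * quat_degree x) (degree v) \<le> dquat_degree C + quat_degree x"
proof -
  from C obtain C' r' where C': "has_factor r' C'"
    and norm: "qinner (primal C') (primal C') = r' * g * qinner x x" and "C' = C \<or> C' = C * dq_i"
    by (rule oriented_representative)
  then have deg: "dquat_degree C = dquat_degree C'" by (auto simp: dquat_degree_mult_dq_i)
  obtain c d where p: "primal C' = x * Quat c 0 0 d" and cd: "c * c + d * d = r' * g"
    and h: "pcnj (cpoly c d) * cpoly (qinner x (dual C')) (qinner (x * qk) (dual C')) =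
              cpoly 0 (smult (1/2) (r' * v))" (is "_ * ?h = _")
    and dvd: "pcnj (cpoly c d) dvd cpoly r' 0"
    using oriented_factorization[OF C' norm] by blast
  let ?e = "cpoly c d" and ?q = "quat_degree x" and ?m = "dquat_degree C'"
  have r': "r' \<noteq> 0" using C' by (simp add: has_factor_def)
  then have e: "?e \<noteq> 0" using cd g_nonzero by auto
  have "degree (pcnj ?e) \<le> degree (cpoly r' 0)"
    using dvd r' by (intro dvd_imp_degree_le) auto
  then have er: "degree ?e \<le> degree r'" by (simp add: degree_cpoly)
  have "degree (pcnj ?e * ?e) = 2 * degree ?e"
    using e by (subst degree_mult_eq) (auto simp del: pcnj_cpoly)
  then have "2 * degree ?e = degree r' + degree g"
    using r' g_nonzero by (simp add: cpoly_cnj_mult cd degree_cpoly degree_mult_eq del: pcnj_cpoly)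
  with er have ge: "degree g \<le> degree ?e" by linarith
  have m: "quat_degree (primal C') \<le> ?m" "quat_degree (dual C') \<le> ?m"
    by (simp_all add: dquat_degree_def)
  then have 1: "degree g + 2 * ?q \<le> ?m + ?q"
    using ge quat_degree_mult_planar[OF x_nonzero e] p by simp
  have "degree v \<le> ?m + ?q"
  \<comment> \<open>For \<open>v = 0\<close> the Hermitian product vanishes, and the bound on
    \<open>degree v\<close> is trivial.\<close>
  proof (cases "v = 0")
    case False
    have "degree ?h \<le> ?q + ?m"
    proof -
      have "quat_degree (x * qk) \<le> ?q"
        using quat_degree_le_iff[of x ?q] by (simp add: quat_degree_le_iff)
      then show ?thesis
        using m(2) by (simp add: degree_cpoly degree_qinner_le)
    qed
    have "?h \<noteq> 0"
    proof
      assume "?h = 0"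
      with h have "cpoly 0 (smult (1/2) (r' * v)) = 0" by (simp only: mult_zero_right)
      with r' False show False by simp
    qed
    then have "degree (pcnj ?e * ?h) = degree ?e + degree ?h"
      using e by (subst degree_mult_eq) (auto simp del: pcnj_cpoly)
    moreover have "degree (pcnj ?e * ?h) = degree r' + degree v"
      unfolding h using r' False by (simp add: degree_cpoly degree_mult_eq)
    ultimately show ?thesis using er \<open>degree ?h \<le> ?q + ?m\<close> by linarith
  qed simp
  with 1 deg show ?thesis by simp
qed

text \<open>With primal part \<open>g * x\<close> the rotated vector is scaled by the square of
  \<open>g\<close> and the scalar part by \<open>g\<close>: one factor \<open>g\<close> more than in
  the torse.\<close>

lemma has_factor_construction:
  assumes "qinner x y = 0" "2 * qinner (x * qk) y = v"
  shows "has_factor g (DQ (Quat g 0 0 0 * x) y)"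
proof -
  have "qinner (Quat g 0 0 0 * x) y = g * qinner x y"
    "qinner (Quat g 0 0 0 * x * qk) y = g * qinner (x * qk) y"
    by (simp_all add: qinner_def algebra_simps)
  moreover have "qrot (Quat g 0 0 0 * x) = Quat (g * g) 0 0 0 * qrot x"
    by (simp add: quat_eq_iff qrot_sel algebra_simps)
  ultimately show ?thesis
    using assms g_nonzero by (simp add: has_factor_iff)
qed

end

section \<open>Displacements fixing the plane\<close>

lemma trajectory_mult:
  "eps_cnj (C * E) * dq_k * dcnj (C * E) = eps_cnj C * (eps_cnj E * dq_k * dcnj E) * dcnj C"
  by (simp add: eps_cnj_mult dcnj_mult mult.assoc)

text \<open>The sign \<open>s\<close> tells whether the orientation of the plane is kept. Tying the
  scaling to the norm makes the property stable under products and conjugation.\<close>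

definition preserves_plane :: "'a::comm_ring_1 dquat \<Rightarrow> bool" where
  "preserves_plane e \<longleftrightarrow> (\<exists>a s. a \<noteq> 0 \<and> (s = 1 \<or> s = - 1) \<and> dnorm e = scalar a \<and>
     eps_cnj e * dq_k * dcnj e = scalar (s * a) * dq_k)"

lemma preserves_plane_mult:
  fixes e f :: "'a::idom dquat"
  assumes "preserves_plane e" "preserves_plane f"
  shows "preserves_plane (e * f)"
proof -
  obtain a s where a: "a \<noteq> 0" "s = 1 \<or> s = - 1" "dnorm e = scalar a"
      "eps_cnj e * dq_k * dcnj e = scalar (s * a) * dq_k"
    using assms(1) by (auto simp: preserves_plane_def)
  obtain b t where b: "b \<noteq> 0" "t = 1 \<or> t = - 1" "dnorm f = scalar b"
      "eps_cnj f * dq_k * dcnj f = scalar (t * b) * dq_k"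
    using assms(2) by (auto simp: preserves_plane_def)
  have "dnorm (e * f) = scalar (b * a)"
    by (simp add: dnorm_mult_scalar[OF b(3)] a(3) scalar_mult)
  moreover have "eps_cnj (e * f) * dq_k * dcnj (e * f) = scalar (t * b) * (eps_cnj e * dq_k * dcnj e)"
    unfolding trajectory_mult b(4) by (simp add: scalar_left_commute mult.assoc)
  then have "eps_cnj (e * f) * dq_k * dcnj (e * f) = scalar (t * s * (b * a)) * dq_k"
    unfolding a(4) by (simp add: dquat_eq_iff quat_eq_iff mult_ac)
  moreover have "t * s = 1 \<or> t * s = - 1" "b * a \<noteq> 0" using a b by auto
  ultimately show ?thesis unfolding preserves_plane_def by blast
qed

text \<open>Conjugation inverts \<open>e\<close> up to its norm: act with \<open>dcnj e\<close> on
  the equation for \<open>e\<close> and cancel.\<close>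

lemma preserves_plane_dcnj:
  fixes e :: "'a::idom dquat"
  assumes "preserves_plane e"
  shows "preserves_plane (dcnj e)"
proof -
  obtain a s where a: "a \<noteq> 0" "s = 1 \<or> s = - 1" "dnorm e = scalar a"
      "eps_cnj e * dq_k * dcnj e = scalar (s * a) * dq_k"
    using assms by (auto simp: preserves_plane_def)
  let ?T = "eps_cnj (dcnj e) * dq_k * dcnj (dcnj e)"
  have norm: "dnorm (dcnj e) = scalar a"
    using a(3) by (simp add: dnorm_def[of "dcnj e"] dcnj_mult_self)
  have "scalar (s * a) * ?T = eps_cnj (dcnj e) * (eps_cnj e * dq_k * dcnj e) * dcnj (dcnj e)"
    unfolding a(4) by (simp add: scalar_left_commute mult.assoc)
  also have "\<dots> = eps_cnj (dcnj e * e) * dq_k * dcnj (dcnj e * e)"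
    by (simp only: trajectory_mult)
  \<comment> \<open>The norm acts on k as \<open>a * a\<close>, and
    \<open>s * s = 1\<close>.\<close>
  also have "\<dots> = scalar (s * a) * (scalar (s * a) * dq_k)"
    using a(2) unfolding dcnj_mult_self a(3)
    by (auto simp: dquat_eq_iff quat_eq_iff dq_k_def)
  finally have "scalar (s * a) * (?T - scalar (s * a) * dq_k) = 0"
    by (simp add: right_diff_distrib)
  then have "?T = scalar (s * a) * dq_k" using a(1,2) by auto
  with a norm show ?thesis unfolding preserves_plane_def by blast
qed

lemma preserves_plane_planar:
  fixes c d :: "'a::idom"
  assumes "c * c + d * d \<noteq> 0"
  shows "preserves_plane (DQ (Quat c 0 0 d) (Quat 0 a b 0))"
  unfolding preserves_plane_def
  by (rule exI[of _ "c * c + d * d"], rule exI[of _ 1])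
     (simp add: assms dnorm_eq dq_k_def dquat_eq_iff quat_eq_iff qinner_def eps_cnj_def dcnj_def algebra_simps)

text \<open>The inverse of the half turn \<open>dq_i\<close>; it serves to undo a change of
  orientation.\<close>

lemma preserves_plane_minus_i: "preserves_plane (- dq_i :: 'a::idom dquat)"
  unfolding preserves_plane_def
  by (rule exI[of _ 1], rule exI[of _ "- 1"])
     (simp add: dnorm_eq dq_k_def dq_i_def dquat_eq_iff quat_eq_iff qinner_def eps_cnj_def dcnj_def)

section \<open>Constant displacements as constant polynomials\<close>

definition const_poly_dq :: "real dquat \<Rightarrow> real poly dquat" where
  "const_poly_dq = map_dquat (\<lambda>a. [:a:])"

lemma const_poly_dq_sel [simp]:
  "primal (const_poly_dq e) = map_quat (\<lambda>a. [:a:]) (primal e)"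
  "dual (const_poly_dq e) = map_quat (\<lambda>a. [:a:]) (dual e)"
  by (simp_all add: const_poly_dq_def dquat.map_sel)

lemma const_poly_dq_mult: "const_poly_dq (x * y) = const_poly_dq x * const_poly_dq y"
  and const_poly_dq_dcnj: "const_poly_dq (dcnj x) = dcnj (const_poly_dq x)"
  and const_poly_dq_eps_cnj: "const_poly_dq (eps_cnj x) = eps_cnj (const_poly_dq x)"
  and const_poly_dq_scalar: "const_poly_dq (scalar a) = scalar [:a:]"
  and const_poly_dq_dq_k: "const_poly_dq dq_k = dq_k"
  and const_poly_dq_minus_i: "const_poly_dq (- dq_i) = - dq_i"
  by (simp_all add: dquat_eq_iff quat_eq_iff dcnj_def eps_cnj_def dq_k_def dq_i_def one_pCons)

lemma of_consts_eq: "of_consts e = of_polys (const_poly_dq e)"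
  by (simp add: of_consts_def dquat_eq_iff quat_eq_iff dquat.map_sel)

lemma preserves_plane_constant:
  assumes "preserves_plane e"
  shows "constant_displacement e" "fixes_plane_k (of_consts e)"
proof -
  obtain a s where a: "a \<noteq> 0" "s = 1 \<or> s = - 1" "dnorm e = scalar a"
      "eps_cnj e * dq_k * dcnj e = scalar (s * a) * dq_k"
    using assms by (auto simp: preserves_plane_def)
  then show "constant_displacement e" by (auto simp: constant_displacement_def dnorm_def)
  have "const_poly_dq (eps_cnj e * dq_k * dcnj e) = scalar [:s * a:] * dq_k"
    unfolding a(4) by (simp only: const_poly_dq_mult const_poly_dq_scalar const_poly_dq_dq_k)
  then have "eps_cnj (const_poly_dq e) * dq_k * dcnj (const_poly_dq e) = scalar [:s * a:] * dq_k"
    by (simp only: const_poly_dq_mult const_poly_dq_dcnj const_poly_dq_eps_cnj const_poly_dq_dq_k)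
  moreover have "[:s * a:] \<noteq> 0" using a(1,2) by auto
  ultimately show "fixes_plane_k (of_consts e)"
    unfolding of_consts_eq by (intro has_trajectory_of_polys[of _ dq_k]) (simp_all add: of_polys_dq_k)
qed

section \<open>Minimal motions\<close>

context reduced_torse
begin

text \<open>Two solutions of the Bezout equation for the dual part differ by a multiple of
  \<open>x j\<close>, and this multiple is constant by the degree bound.\<close>

lemma minimal_motion_form:
  assumes C: "has_factor r C" and deg: "degree g = 0" "dquat_degree C \<le> quat_degree x"
    and y: "qinner x y = 0" "2 * qinner (x * qk) y = v" "quat_degree y \<le> quat_degree x"
  obtains a e where "a \<noteq> 0" "preserves_plane e"
    "scalar a * C = DQ (Quat g 0 0 0 * x) y * const_poly_dq e"
proof -
  from C obtain C' r' where C': "has_factor r' C'"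
    and norm: "qinner (primal C') (primal C') = r' * g * qinner x x" and CC: "C' = C \<or> C' = C * dq_i"
    by (rule oriented_representative)
  then have deg': "dquat_degree C' \<le> quat_degree x"
    using deg(2) by (auto simp: dquat_degree_mult_dq_i)
  obtain c d where p: "primal C' = x * Quat c 0 0 d" and cd: "c * c + d * d = r' * g"
    and h: "pcnj (cpoly c d) * cpoly (qinner x (dual C')) (qinner (x * qk) (dual C')) =
              cpoly 0 (smult (1/2) (r' * v))"
    using oriented_factorization[OF C' norm] by blast
  let ?e = "cpoly c d" and ?q = "quat_degree x" and ?D = "dual C'"
  let ?H = "\<lambda>z. cpoly (qinner x z) (qinner (x * qk) z)"
  have r': "r' \<noteq> 0" using C' by (simp add: has_factor_def)
  then have e: "?e \<noteq> 0" using cd g_nonzero by auto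
  have "quat_degree (primal C') \<le> ?q" "quat_degree ?D \<le> ?q"
    using deg' by (simp_all add: dquat_degree_def)
  \<comment> \<open>The primal part \<open>x * e\<close> has at most the degree of \<open>x\<close>,
    so \<open>e\<close> is constant.\<close>
  then have D: "quat_degree ?D \<le> ?q" and de: "degree ?e = 0"
    using quat_degree_mult_planar[OF x_nonzero e] p by simp_all
  obtain c0 d0 where cd0: "c = [:c0:]" "d = [:d0:]"
    using de by (metis degree_0_id degree_cpoly_le_iff le_zero_eq degree_eq_zeroE)
  obtain \<gamma> where \<gamma>: "g = [:\<gamma>:]" using deg(1) by (rule degree_eq_zeroE)
  with g_nonzero have \<gamma>0: "\<gamma> \<noteq> 0" by auto

  \<comment> \<open>If \<open>scalar g * C'\<close> is the reference motion times a displacement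
    with primal part \<open>c + d k\<close>, then \<open>X\<close> must be \<open>g * x\<close>
    times the dual part of that displacement.\<close>
  define X where "X = Quat g 0 0 0 * ?D - y * Quat c 0 0 d"
  have X: "qfst X = cpoly g 0 * qfst ?D - qfst y * ?e" "qsnd X = cpoly g 0 * qsnd ?D - qsnd y * ?e"
    by (simp_all add: X_def qpair_diff qfst_mult qsnd_mult)
  have "qinner (x * qk) y = smult (1/2) (2 * qinner (x * qk) y)"
    by (simp add: numeral_poly)
  then have Hy: "?H y = cpoly 0 (smult (1/2) v)" by (simp only: y)
  have "pcnj ?e * ?H ?D = cpoly r' 0 * ?H y"
    unfolding h Hy by (simp add: cpoly_real_mult)
  \<comment> \<open>Multiplying by \<open>?e\<close> produces the norm \<open>r' * g\<close>, after
    which \<open>r'\<close> cancels.\<close>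
  then have "?e * pcnj ?e * ?H ?D = cpoly r' 0 * ?e * ?H y" by algebra
  moreover have "?e * pcnj ?e = cpoly r' 0 * cpoly g 0"
    using cpoly_cnj_mult[of c d] by (simp add: mult.commute cd cpoly_real_mult)
  ultimately have "cpoly r' 0 * (cpoly g 0 * ?H ?D) = cpoly r' 0 * (?e * ?H y)"
    by (simp only: mult.assoc)
  then have "cpoly g 0 * ?H ?D = ?e * ?H y" using r' by simp
  then have "cpoly g 0 * (pcnj (qfst x) * qfst ?D + pcnj (qsnd x) * qsnd ?D) =
      ?e * (pcnj (qfst x) * qfst y + pcnj (qsnd x) * qsnd y)"
    by (simp only: hermitian_eq)
  \<comment> \<open>\<open>X\<close> is orthogonal to \<open>x\<close> for the Hermitian product,
    hence a multiple of \<open>(conj b, - conj a)\<close>, where \<open>(a, b)\<close> is the pair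
    of \<open>x\<close>.\<close>
  then have "qfst X * - pcnj (qfst x) = qsnd X * pcnj (qsnd x)"
    unfolding X by algebra
  moreover have "coprime (pcnj (qsnd x)) (- pcnj (qfst x))"
    using coprime_pcnj[OF coprime_pair] by (simp add: coprime_commute)
  ultimately obtain l where l: "qfst X = pcnj (qsnd x) * l" "qsnd X = - pcnj (qfst x) * l"
    using proportional_to_coprime by metis
  obtain l0 l1 where l01: "l = cpoly l0 l1" by (metis cpoly_cases)
  have X_eq: "X = x * Quat (- l0) 0 0 l1 * Quat 0 1 0 0"
    using l unfolding l01 qpair_eq_iff qfst_mult qsnd_mult
    by (simp add: qfst_def[of "Quat 0 1 0 0"] qsnd_def[of "Quat 0 1 0 0"] pcnj_mult flip: cpoly_minus)
  have "degree (cpoly g 0) = 0" using deg(1) by (simp add: degree_cpoly)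
  then have *: "degree (cpoly g 0 * a - b * ?e) \<le> ?q" if "degree a \<le> ?q" "degree b \<le> ?q" for a b
    using that de degree_mult_le[of "cpoly g 0" a] degree_mult_le[of b ?e]
    by (intro degree_diff_le) auto
  have "quat_degree X \<le> ?q"
    using D y(3) unfolding quat_degree_qpair_le_iff X by (auto intro: *)
  then have "quat_degree (x * Quat (- l0) 0 0 l1) \<le> ?q"
    unfolding X_eq by (simp only: quat_degree_mult_i)
  \<comment> \<open>The multiplier is constant because \<open>X\<close> has at most the degree of
    \<open>x\<close>.\<close>
  then have "degree (cpoly (- l0) l1) = 0"
    using quat_degree_mult_planar[OF x_nonzero, of "- l0" l1] by (cases "cpoly (- l0) l1 = 0") auto
  then obtain m0 m1 where m: "- l0 = [:m0:]" "l1 = [:m1:]"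
    by (metis degree_cpoly_le_iff le_zero_eq degree_eq_zeroE)

  \<comment> \<open>Division by the constant \<open>\<gamma>\<close> compensates the factor
    \<open>g\<close> in the primal part of the reference motion.\<close>
  define f where "f = DQ (Quat c0 0 0 d0) (Quat 0 (m0 / \<gamma>) (m1 / \<gamma>) 0)"
  have "Quat (- l0) 0 0 l1 * Quat 0 1 0 0 = Quat 0 [:m0:] [:m1:] 0"
    unfolding m by (simp add: quat_eq_iff)
  then have "X = x * Quat 0 [:m0:] [:m1:] 0" using X_eq by (simp add: mult.assoc)
  then have gD: "Quat g 0 0 0 * ?D = x * Quat 0 [:m0:] [:m1:] 0 + y * Quat c 0 0 d"
    unfolding X_def by (simp add: diff_eq_eq)
  have eq: "scalar g * C' = DQ (Quat g 0 0 0 * x) y * const_poly_dq f"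
  proof -
    have "Quat g 0 0 0 * x * Quat 0 [:m0 / \<gamma>:] [:m1 / \<gamma>:] 0 = x * Quat 0 [:m0:] [:m1:] 0"
      using \<gamma>0 by (simp add: quat_eq_iff \<gamma> algebra_simps)
    moreover have "map_quat (\<lambda>a. [:a:]) (Quat 0 (m0 / \<gamma>) (m1 / \<gamma>) 0) = Quat 0 [:m0 / \<gamma>:] [:m1 / \<gamma>:] 0"
      "map_quat (\<lambda>a. [:a:]) (Quat c0 0 0 d0) = Quat c 0 0 d"
      by (simp_all add: quat_eq_iff cd0)
    ultimately show ?thesis
      using gD p by (simp add: dquat_eq_iff f_def mult.assoc)
  qed
  have "c0 * c0 + d0 * d0 \<noteq> 0"
  proof
    assume "c0 * c0 + d0 * d0 = 0"
    then have "c0 = 0 \<and> d0 = 0" by (simp add: sum_squares_eq_zero_iff)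
    with e show False by (simp add: cd0)
  qed
  then have f: "preserves_plane f" unfolding f_def by (rule preserves_plane_planar)
  from CC show ?thesis
  proof
    assume "C' = C"
    with that[OF g_nonzero f] eq show ?thesis by simp
  next
    assume "C' = C * dq_i"
    then have "C = C' * - dq_i" by (simp add: dquat_eq_iff quat_eq_iff dq_i_def)
    then have "scalar g * C = DQ (Quat g 0 0 0 * x) y * const_poly_dq (f * - dq_i)"
      unfolding const_poly_dq_mult const_poly_dq_minus_i by (metis eq mult.assoc)
    with that[OF g_nonzero preserves_plane_mult[OF f preserves_plane_minus_i]] show ?thesis .
  qed
qed

text \<open>Used to recognize inequivalent motions. Comparing primal parts shows that the primal
  part of \<open>e\<close> is \<open>1 / s\<close>, so \<open>s\<close> is constant; comparing dual
  parts then makes \<open>l\<close> equal to \<open>s * g\<close> times a constant.\<close>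

lemma shifted_solution_equivalent:
  assumes "point (of_polys (DQ (Quat g 0 0 0 * x) (y + x * Quat 0 l 0 0))) =
      point (of_polys (DQ (Quat g 0 0 0 * x) y) * of_consts e)"
  obtains c where "l = smult c g"
proof -
  let ?F = "to_fract :: real poly \<Rightarrow> ratfun"
  obtain s where s: "s \<noteq> 0"
    and eq: "of_polys (DQ (Quat g 0 0 0 * x) (y + x * Quat 0 l 0 0)) =
      scalar s * (of_polys (DQ (Quat g 0 0 0 * x) y) * of_consts e)"
    using assms by (auto simp: point_eq_iff)
  let ?x = "map_quat ?F x" and ?y = "map_quat ?F y" and ?g = "Quat (?F g) 0 0 0"
  let ?ep = "primal (of_consts e)" and ?ed = "dual (of_consts e)" and ?s = "Quat s 0 0 0"
  \<comment> \<open>Multiply by the conjugate of \<open>x\<close>; its product with \<open>x\<close>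
    is a nonzero scalar.\<close>
  have cancel: "a = b" if "?x * a = ?x * b" for a b
  proof -
    have "qcnj ?x * (?x * (a - b)) = 0" using that by (simp add: right_diff_distrib)
    then have "Quat (qinner ?x ?x) 0 0 0 * (a - b) = 0"
      by (simp add: quat_eq_iff qinner_def algebra_simps)
    moreover have "qinner ?x ?x \<noteq> 0"
      using x_nonzero by (simp add: map_quat_to_fract_qinner)
    ultimately have "a - b = 0" by (auto simp: quat_eq_iff)
    then show ?thesis by simp
  qed
  have "?g * ?x = ?s * (?g * ?x * ?ep)"
    using arg_cong[OF eq, of primal] by (simp add: quat_eq_iff)
  then have "?x * ?g = ?x * (?g * (?s * ?ep))"
    by (simp add: quat_eq_iff algebra_simps)
  then have "?g = ?g * (?s * ?ep)" by (rule cancel)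
  then have ep: "?s * ?ep = 1"
    using g_nonzero by (simp add: quat_eq_iff)
  have "?y + ?x * Quat 0 (?F l) 0 0 = ?s * (?g * ?x * ?ed + ?y * ?ep)"
    using arg_cong[OF eq, of dual] by (simp add: quat_eq_iff)
  also have "\<dots> = ?x * (?s * ?g * ?ed) + ?y * (?s * ?ep)"
    by (simp add: quat_eq_iff algebra_simps)
  finally have "?x * Quat 0 (?F l) 0 0 = ?x * (?s * ?g * ?ed)" by (simp add: ep)
  then have "Quat 0 (?F l) 0 0 = ?s * ?g * ?ed" by (rule cancel)
  then have l: "?F l = s * ?F g * ?F [:q1 (dual e):]"
    by (simp add: quat_eq_iff of_consts_eq)
  have se: "s * ?F [:q0 (primal e):] = 1"
    using ep by (simp add: quat_eq_iff of_consts_eq)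
  then have "q0 (primal e) \<noteq> 0" by auto
  then have "?F [:1 / q0 (primal e):] * ?F [:q0 (primal e):] = 1"
    by (simp flip: to_fract_mult one_pCons)
  with se have "s * ?F [:q0 (primal e):] = ?F [:1 / q0 (primal e):] * ?F [:q0 (primal e):]"
    by (simp only:)
  then have "s = ?F [:1 / q0 (primal e):]"
    using \<open>q0 (primal e) \<noteq> 0\<close> by simp
  with l have "?F l = ?F ([:1 / q0 (primal e):] * g * [:q1 (dual e):])"
    by (simp only: to_fract_mult)
  then have "l = smult (q1 (dual e) / q0 (primal e)) g" by simp
  then show ?thesis by (rule that)
qed

end

section \<open>Composition with motions fixing the plane\<close>

text \<open>Scalar norms multiply, so this form shows that motions are closed under products and
  conjugation.\<close>

lemma rational_motion_iff_dnorm: "rational_motion C \<longleftrightarrow> (\<exists>a. a \<noteq> 0 \<and> dnorm C = scalar a)"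
  by (auto simp: rational_motion_iff dnorm_eq dquat_eq_iff quat_eq_iff)

lemma rational_motion_mult:
  assumes "rational_motion C" "rational_motion E"
  shows "rational_motion (C * E)"
proof -
  obtain a b where "a \<noteq> 0" "dnorm C = scalar a" "b \<noteq> 0" "dnorm E = scalar b"
    using assms by (auto simp: rational_motion_iff_dnorm)
  then have "dnorm (C * E) = scalar (b * a)" "b * a \<noteq> 0"
    by (simp_all add: dnorm_mult_scalar scalar_mult)
  then show ?thesis unfolding rational_motion_iff_dnorm by blast
qed

lemma rational_motion_dcnj: "rational_motion C \<Longrightarrow> rational_motion (dcnj C)"
  by (auto simp: rational_motion_iff_dnorm dnorm_def[of "dcnj C"] dcnj_mult_self)

text \<open>Given \<open>C'\<close>, take \<open>E = dcnj C * C'\<close>: it fixes the plane because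
  \<open>dcnj C\<close> undoes \<open>C\<close> up to its norm, and \<open>C * E\<close> is a scalar
  multiple of \<open>C'\<close>.\<close>

lemma motions_with_trajectory:
  assumes C: "rational_motion C" "has_trajectory C u"
  shows "{point C' | C'. rational_motion C' \<and> has_trajectory C' u} =
         {point (C * E) | E. rational_motion E \<and> fixes_plane_k E}"
proof (intro set_eqI iffI)
  fix X assume "X \<in> {point C' | C'. rational_motion C' \<and> has_trajectory C' u}"
  then obtain C' where C': "X = point C'" "rational_motion C'" "has_trajectory C' u" by blast
  obtain a where a: "a \<noteq> 0" "dnorm C = scalar a"
    using C(1) by (auto simp: rational_motion_iff_dnorm)
  obtain r where r: "r \<noteq> 0"
    "eps_cnj C' * dq_k * dcnj C' = scalar r * (eps_cnj C * dq_k * dcnj C)"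
    using C(2) C'(3) by (metis has_trajectory_def point_eq_iff)
  have "eps_cnj (dcnj C * C') * dq_k * dcnj (dcnj C * C') =
      scalar r * (eps_cnj (dcnj C * C) * dq_k * dcnj (dcnj C * C))"
    unfolding trajectory_mult r(2) by (simp add: scalar_left_commute mult.assoc)
  also have "\<dots> = scalar (r * a * a) * dq_k"
    unfolding dcnj_mult_self a(2) by (simp add: dquat_eq_iff quat_eq_iff dq_k_def)
  finally have "fixes_plane_k (dcnj C * C')"
    using a(1) r(1) by (simp add: has_trajectory_def)
  moreover have "rational_motion (dcnj C * C')"
    using C(1) C'(2) by (intro rational_motion_mult rational_motion_dcnj)
  moreover have "C * (dcnj C * C') = scalar a * C'"
    by (simp add: a(2)[symmetric] dnorm_def mult.assoc)
  then have "X = point (C * (dcnj C * C'))" using a(1) C'(1) by simp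
  ultimately show "X \<in> {point (C * E) | E. rational_motion E \<and> fixes_plane_k E}" by blast
next
  fix X assume "X \<in> {point (C * E) | E. rational_motion E \<and> fixes_plane_k E}"
  then obtain E where E: "X = point (C * E)" "rational_motion E" "fixes_plane_k E" by blast
  obtain r where r: "r \<noteq> 0" "eps_cnj E * dq_k * dcnj E = scalar r * dq_k"
    using E(3)[unfolded has_trajectory_def, symmetric] by (auto simp: point_eq_iff)
  have "eps_cnj (C * E) * dq_k * dcnj (C * E) = scalar r * (eps_cnj C * dq_k * dcnj C)"
    unfolding trajectory_mult r(2) by (simp add: scalar_left_commute mult.assoc)
  then have "has_trajectory (C * E) u"
    using C(2) r(1) by (simp add: has_trajectory_def)
  moreover have "rational_motion (C * E)" using C(1) E(2) by (rule rational_motion_mult)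
  ultimately show "X \<in> {point C' | C'. rational_motion C' \<and> has_trajectory C' u}"
    using E(1) by blast
qed

section \<open>The shape of motions fixing the plane\<close>

lemma planar_shapeI:
  assumes "q1 (primal E) = 0" "q2 (primal E) = 0" "q0 (dual E) = 0" "q3 (dual E) = 0"
  shows "planar_shape E"
proof -
  obtain h where h: "of_polys h \<in> point E" using polynomial_representative by blast
  then obtain r where "of_polys h = scalar r * E" by (auto simp: point_def)
  then have "of_polys h = of_polys (DQ (Quat (q0 (primal h)) 0 0 (q3 (primal h)))
      (Quat 0 (q1 (dual h)) (q2 (dual h)) 0))"
    using assms by (simp add: dquat_eq_iff quat_eq_iff)
  with h show ?thesis unfolding planar_shape_def in_point_iff by metis
qed

text \<open>If k is rotated into a multiple of itself, the primal part lies in the span of 1, k or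
  of i, j. The Study condition and the trajectory then form a homogeneous linear system for two dual
  coordinates, whose determinant is, up to sign, the nonzero norm of the primal part. The second
  family becomes planar after a half turn.\<close>

lemma fixes_plane_k_shape:
  assumes E: "rational_motion E" "fixes_plane_k E"
  shows "(eps_cnj E * dq_k * dcnj E = dnorm E * dq_k \<and> planar_shape E) \<or>
         (eps_cnj E * dq_k * dcnj E = - (dnorm E * dq_k) \<and> planar_shape (E * dq_i))"
proof -
  let ?p = "primal E" and ?d = "dual E"
  obtain r where r: "r \<noteq> 0" "eps_cnj E * dq_k * dcnj E = scalar r * dq_k"
    using E(2)[unfolded has_trajectory_def, symmetric] by (auto simp: point_eq_iff)
  have study: "q0 ?p * q0 ?d + q1 ?p * q1 ?d + q2 ?p * q2 ?d + q3 ?p * q3 ?d = 0" and "?p \<noteq> 0"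
    using E(1) by (simp_all add: rational_motion_iff qinner_def)
  from r(2) have rot: "q1 ?p * q3 ?p + q0 ?p * q2 ?p = 0" "q2 ?p * q3 ?p - q0 ?p * q1 ?p = 0"
    and dual: "- q3 ?p * q0 ?d + q2 ?p * q1 ?d - q1 ?p * q2 ?d + q0 ?p * q3 ?d = 0"
    unfolding trajectory_eq
    by (auto simp: dquat_eq_iff quat_eq_iff qrot_sel dq_k_def qinner_def)
  \<comment> \<open>The left side is the sum of the squares of the two expressions in
    \<open>rot\<close>.\<close>
  have "(q0 ?p * q0 ?p + q3 ?p * q3 ?p) * (q1 ?p * q1 ?p + q2 ?p * q2 ?p) = 0"
    using rot by algebra
  then consider "q1 ?p = 0" "q2 ?p = 0" | "q0 ?p = 0" "q3 ?p = 0"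
    by (auto simp: sum_squares_eq_zero_iff)
  then show ?thesis
  proof cases
    case 1
    then have "q0 ?p * q0 ?p + q3 ?p * q3 ?p \<noteq> 0"
      using \<open>?p \<noteq> 0\<close> by (auto simp: sum_squares_eq_zero_iff quat_eq_iff)
    moreover have "(q0 ?p * q0 ?p + q3 ?p * q3 ?p) * q0 ?d = 0"
      "(q0 ?p * q0 ?p + q3 ?p * q3 ?p) * q3 ?d = 0"
      using study dual unfolding 1 by algebra+
    ultimately have d: "q0 ?d = 0" "q3 ?d = 0" by (simp_all only: mult_eq_0_iff simp_thms)
    have "eps_cnj E * dq_k * dcnj E = dnorm E * dq_k"
      using study unfolding trajectory_eq dnorm_eq
      by (simp add: dquat_eq_iff quat_eq_iff qrot_sel dq_k_def qinner_def 1 d)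
    moreover have "planar_shape E" using 1 d by (rule planar_shapeI)
    ultimately show ?thesis by blast
  next
    case 2
    then have "q1 ?p * q1 ?p + q2 ?p * q2 ?p \<noteq> 0"
      using \<open>?p \<noteq> 0\<close> by (auto simp: sum_squares_eq_zero_iff quat_eq_iff)
    moreover have "(q1 ?p * q1 ?p + q2 ?p * q2 ?p) * q1 ?d = 0"
      "(q1 ?p * q1 ?p + q2 ?p * q2 ?p) * q2 ?d = 0"
      using study dual unfolding 2 by algebra+
    ultimately have d: "q1 ?d = 0" "q2 ?d = 0" by (simp_all only: mult_eq_0_iff simp_thms)
    have "eps_cnj E * dq_k * dcnj E = - (dnorm E * dq_k)"
      using study unfolding trajectory_eq dnorm_eq
      by (simp add: dquat_eq_iff quat_eq_iff qrot_sel dq_k_def qinner_def 2 d)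
    moreover have "planar_shape (E * dq_i)"
      by (rule planar_shapeI) (simp_all add: dq_i_def 2 d)
    ultimately show ?thesis by blast
  qed
qed

theorem theorem1:
  fixes u n :: "ratfun dquat"
  assumes "rational_kinematic_torse u" and "gauss_map u n"
  defines "deg_u \<equiv> point_degree (point u)"
    and "deg_n \<equiv> point_degree (point n)"
  shows
    "(\<exists>C. rational_motion C \<and> has_trajectory C u \<and>
        real (point_degree (point C)) = real deg_u - real deg_n / 2) \<and>
     (\<forall>C. rational_motion C \<and> has_trajectory C u \<longrightarrow>
        real (point_degree (point C)) \<ge> real deg_u - real deg_n / 2) \<and>
     (essentially_unique_minimal_motion u \<longleftrightarrow> deg_u = deg_n) \<and>
     (\<forall>C. minimal_motion u C \<longrightarrow>
        {point C' | C'. rational_motion C' \<and> has_trajectory C' u} =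
        {point (C * E) | E. rational_motion E \<and> fixes_plane_k E}) \<and>
     (\<forall>E. rational_motion E \<and> fixes_plane_k E \<longrightarrow>
        (eps_cnj E * dq_k * dcnj E = dnorm E * dq_k \<and> planar_shape E) \<or>
        (eps_cnj E * dq_k * dcnj E = - (dnorm E * dq_k) \<and> planar_shape (E * dq_i)))"
proof -
  obtain g x v where gxv: "coprime (qfst x) (qsnd x)" "g \<noteq> 0" "coprime g v"
    and u: "point u = point (of_polys (torse g x v))" and prim: "dq_primitive (torse g x v)"
    and deg_u_torse: "point_degree (point u) = dquat_degree (torse g x v)"
    and deg_n_x: "point_degree (point n) = 2 * quat_degree x"
    by (rule torse_normal_form[OF assms(1,2)])
  interpret reduced_torse g v x by standard (fact gxv)+
  let ?q = "quat_degree x"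
  have deg_u: "deg_u = max (degree g + 2 * ?q) (degree v)"
    using deg_u_torse by (simp add: deg_u_def dquat_degree_torse[OF g_nonzero x_nonzero])
  have deg_n: "deg_n = 2 * ?q" using deg_n_x by (simp add: deg_n_def)
  have du: "degree g + 2 * ?q \<le> deg_u" "degree v \<le> deg_u" by (simp_all add: deg_u)

  have factor: "\<exists>r. has_factor r C" if C: "rational_motion (of_polys C)" "has_trajectory (of_polys C) u" for C
  proof -
    obtain r where "r \<noteq> 0" "eps_cnj C * dq_k * dcnj C = scalar r * torse g x v"
      using has_trajectory_of_polysD[OF u prim C(2)] by blast
    with C(1) show ?thesis by (auto simp: has_factor_def rational_motion_of_polys)
  qed
  have lower: "deg_u - ?q \<le> point_degree (point C)" if C: "rational_motion C" "has_trajectory C u" for C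
  proof -
    obtain h where h: "of_polys h \<in> point C" "dquat_degree h = point_degree (point C)"
      by (rule minimal_representative)
    obtain r where "has_factor r h" using factor motion_representative[OF C h(1)] by blast
    from degree_lower_bound[OF this] h(2) show ?thesis unfolding deg_u by linarith
  qed
  obtain y where y: "qinner x y = 0" "2 * qinner (x * qk) y = v" "quat_degree y \<le> deg_u - ?q"
    using exists_dual_part[OF coprime_pair, of deg_u v] du by auto
  \<comment> \<open>These candidates share the primal part \<open>g * x\<close>; the dual part
    varies over solutions of the Bezout equation.\<close>
  define C where "C z = DQ (Quat g 0 0 0 * x) z" for z
  have C_traj: "rational_motion (of_polys (C z))" "has_trajectory (of_polys (C z)) u"
    and C_deg: "point_degree (point (of_polys (C z))) = deg_u - ?q"
    if z: "qinner x z = 0" "2 * qinner (x * qk) z = v" "quat_degree z \<le> deg_u - ?q" for z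
  proof -
    have fac: "has_factor g (C z)" unfolding C_def using z by (intro has_factor_construction)
    have comm: "Quat g 0 0 0 * x = x * Quat g 0 0 0" by (simp add: quat_eq_iff)
    have degp: "quat_degree (Quat g 0 0 0 * x) = ?q + degree g"
      unfolding comm using quat_degree_mult_planar[OF x_nonzero, of g 0] g_nonzero
      by (simp add: degree_cpoly)
    have "primal (C z) \<noteq> 0"
      using x_nonzero g_nonzero by (auto simp: C_def quat_eq_iff)
    with fac show 1: "rational_motion (of_polys (C z))"
      by (simp add: has_factor_def rational_motion_of_polys)
    show 2: "has_trajectory (of_polys (C z)) u"
      using fac has_trajectory_of_polys[OF u] by (auto simp: has_factor_def)
    have "dquat_degree (C z) \<le> deg_u - ?q"
      using degp z(3) du(1) by (simp add: C_def dquat_degree_def)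
    then have "point_degree (point (of_polys (C z))) \<le> deg_u - ?q"
      using point_degree_le[of "C z" "of_polys (C z)"] by simp
    with lower[OF 1 2] show "point_degree (point (of_polys (C z))) = deg_u - ?q" by simp
  qed
  \<comment> \<open>The lower bound is attained, so minimality means having exactly this
    degree.\<close>
  have minimal_iff: "minimal_motion u M \<longleftrightarrow>
      rational_motion M \<and> has_trajectory M u \<and> point_degree (point M) = deg_u - ?q" for M
    unfolding minimal_motion_def using lower C_traj[OF y] C_deg[OF y] by (metis le_antisym)
  \<comment> \<open>\<open>deg_u\<close> is at least twice \<open>?q\<close>, so the natural
    subtraction is not truncated.\<close>
  have half: "real deg_u - real deg_n / 2 = real (deg_u - ?q)"
    using du(1) by (simp add: deg_n of_nat_diff)

  have unique: "essentially_unique_minimal_motion u" if "deg_u = deg_n"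
    unfolding essentially_unique_minimal_motion_def
  proof (intro allI impI, elim conjE)
    fix M M' assume M: "minimal_motion u M" "minimal_motion u M'"
    \<comment> \<open>Equality of the degrees forces \<open>g\<close> to be constant and bounds
      minimal motions by the degree of \<open>x\<close>.\<close>
    have deg: "degree g = 0" "deg_u - ?q = ?q" using that du(1) deg_n by linarith+
    have form: "\<exists>e. preserves_plane e \<and> point M = point (of_polys (C y) * of_consts e)"
      if "minimal_motion u M" for M
    proof -
      have M: "rational_motion M" "has_trajectory M u" "point_degree (point M) = ?q"
        using that deg(2) by (simp_all add: minimal_iff)
      obtain h where h: "of_polys h \<in> point M" "dquat_degree h = point_degree (point M)"
        by (rule minimal_representative)
      obtain r where r: "has_factor r h" using factor motion_representative[OF M(1,2) h(1)] by blast
      have "dquat_degree h \<le> ?q" "quat_degree y \<le> ?q" using h(2) M(3) y(3) deg(2) by simp_all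
      with r deg(1) y(1,2) obtain a e where e: "a \<noteq> 0" "preserves_plane e"
        "scalar a * h = C y * const_poly_dq e"
        unfolding C_def by (metis minimal_motion_form)
      have "point M = point (scalar (to_fract a) * of_polys h)"
        using h(1) e(1) by (simp add: in_point_iff)
      also have "scalar (to_fract a) * of_polys h = of_polys (C y) * of_consts e"
        by (simp add: of_consts_eq e(3) flip: of_polys_scalar of_polys_mult)
      finally show ?thesis using e(2) by blast
    qed
    obtain e where e: "preserves_plane e" "point M = point (of_polys (C y) * of_consts e)"
      using form[OF M(1)] by blast
    obtain e' where e': "preserves_plane e'" "point M' = point (of_polys (C y) * of_consts e')"
      using form[OF M(2)] by blast
    obtain a where a: "a \<noteq> 0" "dnorm e = scalar a"
      using e(1) by (auto simp: preserves_plane_def)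
    obtain s where s: "s \<noteq> 0" "M = scalar s * (of_polys (C y) * of_consts e)"
      using e(2) by (auto simp: point_eq_iff)
    \<comment> \<open>\<open>dcnj e * e'\<close> serves as the quotient of the two displacements;
      the norm of \<open>e\<close> merely rescales.\<close>
    have "const_poly_dq e * const_poly_dq (dcnj e * e') = scalar [:a:] * const_poly_dq e'"
      using a(2) by (simp add: dnorm_def flip: const_poly_dq_scalar const_poly_dq_mult mult.assoc)
    then have ee: "of_consts e * of_consts (dcnj e * e') = scalar (to_fract [:a:]) * of_consts e'"
      unfolding of_consts_eq by (simp flip: of_polys_mult of_polys_scalar)
    have "M * of_consts (dcnj e * e') =
        scalar s * (scalar (to_fract [:a:]) * (of_polys (C y) * of_consts e'))"
      by (simp only: s(2) mult.assoc ee scalar_left_commute[of "of_polys (C y)"])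
    then have "point M' = point (M * of_consts (dcnj e * e'))"
      using s(1) a(1) e'(2) by simp
    moreover have "preserves_plane (dcnj e * e')"
      using e(1) e'(1) by (intro preserves_plane_mult preserves_plane_dcnj)
    ultimately show "\<exists>e. constant_displacement e \<and> fixes_plane_k (of_consts e) \<and>
        point M' = point (M * of_consts e)"
      using preserves_plane_constant by blast
  qed

  have not_unique: "deg_u = deg_n" if unique: "essentially_unique_minimal_motion u"
  proof (rule ccontr)
    assume "deg_u \<noteq> deg_n"
    with du(1) deg_n have gap: "?q + 1 \<le> deg_u - ?q" by linarith
    \<comment> \<open>Adding \<open>x i l\<close> to \<open>y\<close> changes neither the Study
      condition nor the trajectory, and the gap leaves room for \<open>l\<close> of degree
      1.\<close>
    have "\<exists>c. l = smult c g" if "degree l \<le> 1" for l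
    proof -
      have "x * Quat 0 l 0 0 = x * Quat l 0 0 0 * Quat 0 1 0 0" by (simp add: quat_eq_iff)
      then have "quat_degree (x * Quat 0 l 0 0) = quat_degree (x * Quat l 0 0 0)"
        by (simp only: quat_degree_mult_i)
      also have "\<dots> \<le> ?q + degree l"
      proof (cases "l = 0")
        case True
        then have "x * Quat l 0 0 0 = 0" by (simp add: quat_eq_iff)
        then show ?thesis by simp
      next
        case False
        then show ?thesis
          using quat_degree_mult_planar[OF x_nonzero, of l 0] by (simp add: degree_cpoly)
      qed
      finally have "quat_degree (x * Quat 0 l 0 0) \<le> ?q + degree l" .
      then have "quat_degree (x * Quat 0 l 0 0) \<le> deg_u - ?q" using that gap by linarith
      with y(3) have d: "quat_degree (y + x * Quat 0 l 0 0) \<le> deg_u - ?q"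
        unfolding quat_degree_qpair_le_iff qpair_add by (auto intro: degree_add_le)
      have "qinner x (y + x * Quat 0 l 0 0) = qinner x y"
        "qinner (x * qk) (y + x * Quat 0 l 0 0) = qinner (x * qk) y"
        by (simp_all add: qinner_def algebra_simps)
      with y d have z: "qinner x (y + x * Quat 0 l 0 0) = 0"
        "2 * qinner (x * qk) (y + x * Quat 0 l 0 0) = v"
        "quat_degree (y + x * Quat 0 l 0 0) \<le> deg_u - ?q" by simp_all
      have "minimal_motion u (of_polys (C y))" "minimal_motion u (of_polys (C (y + x * Quat 0 l 0 0)))"
        using C_traj[OF y] C_deg[OF y] C_traj[OF z] C_deg[OF z] by (simp_all add: minimal_iff)
      with unique obtain e where
        "point (of_polys (C (y + x * Quat 0 l 0 0))) = point (of_polys (C y) * of_consts e)"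
        unfolding essentially_unique_minimal_motion_def by blast
      then show ?thesis unfolding C_def by (rule shifted_solution_equivalent) blast
    qed
    \<comment> \<open>Both 1 and t would be constant multiples of the same polynomial
      \<open>g\<close>, giving it degree 0 and degree 1.\<close>
    from this[of 1] this[of "[:0, 1:]"] obtain c c' where "1 = smult c g" "[:0, 1:] = smult c' g"
      by auto
    then have "degree (smult c g) = 0" "degree (smult c' g) = 1" "c \<noteq> 0" "c' \<noteq> 0"
      by (metis degree_1, metis degree_pCons_eq_if one_neq_zero One_nat_def degree_1 one_pCons, auto)
    then show False by simp
  qed

  show ?thesis
    using C_traj[OF y] C_deg[OF y] lower unique not_unique
      motions_with_trajectory[of _ u] fixes_plane_k_shape
    unfolding half minimal_iff of_nat_le_iff of_nat_eq_iff by blast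
qed

end
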